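(* (Faber–Krahn inequality for the logarithmic Laplacian.) Let $\rho>0$. Among all bounded Lipschitz domains $\Omega\subset\mathbb{R}^N$ with $|\Omega| = \rho$, the ball $B=B_r(0)$ with $|B|=\rho$ minimizes $\lambda_1^L(\Omega)$; that is, $\lambda_1^L(B)\le\lambda_1^L(\Omega)$ for every bounded Lipschitz domain $\Omega$ with $|\Omega|=\rho$.
   Context: $N\ge1$; $|\cdot|$ is Lebesgue measure; $B_r(0)$ is the open ball of radius $r$ centered at $0$. $c_N= \pi^{-N/2}\Gamma(N/2)$, $\rho_N=2 \log 2 + \psi(\frac{N}{2}) -\gamma$, with $\psi=\Gamma'/\Gamma$ and $\gamma=-\Gamma'(1)$. For a bounded domain $\Omega$, $\mathbb{H}(\Omega)$ is the space of measurable $u:\mathbb{R}^N\to\mathbb{R}$ with $u\equiv0$ on $\mathbb{R}^N\setminus\Omega$ and $\iint_{|x-y|\le1}\frac{(u(x)-u(y))^2}{|x-y|^N}\,dx\,dy<\infty$ (it is contained in $L^2(\Omega)$), and on $\mathbb{H}(\Omega)$ $$\mathcal{E}_L(u,w)=\frac{c_N}{2}\iint_{|x-y|\le1}\frac{(u(x)-u(y))(w(x)-w(y))}{|x-y|^N}\,dx\,dy-c_N\iint_{|x-y|\ge1}\frac{u(x)w(y)}{|x-y|^N}\,dx\,dy+\rho_N\int_{\mathbb{R}^N}uw\,dx .$$ $\lambda_1^L(\Omega)=\min\{\mathcal{E}_L(u,u):u\in\mathbb{H}(\Omega),\ \|u\|_{L^2(\Omega)}=1\}$ is the first Dirichlet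 eigenvalue of the logarithmic Laplacian on $\Omega$. *)

theory Defs
  imports "HOL-Analysis.Analysis"
begin

text \<open>The space R^N is an arbitrary Euclidean space \<open>'a\<close> with \<open>N = DIM('a)\<close>. Single integrals are
  taken with respect to Lebesgue measure on \<open>'a\<close>, double integrals with respect to Lebesgue
  measure on \<open>'a \<times> 'a\<close>.\<close>

text \<open>Near every boundary point, \<open>\<Omega>\<close> is the strict supergraph, in the direction of a unit vector
  \<open>e\<close>, of a Lipschitz function \<open>g\<close> on the hyperplane orthogonal to \<open>e\<close>; the vector
  \<open>x - (x \<bullet> e) *\<^sub>R e\<close> is the orthogonal projection of \<open>x\<close> onto that hyperplane. As \<open>U\<close> is open,
  the boundary of \<open>\<Omega>\<close> inside \<open>U\<close> is then the graph of \<open>g\<close>.\<close>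

definition lipschitz_boundary :: "'a::euclidean_space set \<Rightarrow> bool" where
  "lipschitz_boundary \<Omega> \<longleftrightarrow>
     (\<forall>p\<in>frontier \<Omega>. \<exists>U e C g. open U \<and> p \<in> U \<and> norm e = 1 \<and>
        C-lipschitz_on {y. y \<bullet> e = 0} (g :: 'a \<Rightarrow> real) \<and>
        \<Omega> \<inter> U = {x \<in> U. g (x - (x \<bullet> e) *\<^sub>R e) < x \<bullet> e})"

definition bounded_lipschitz_domain :: "'a::euclidean_space set \<Rightarrow> bool" where
  "bounded_lipschitz_domain \<Omega> \<longleftrightarrow>
     open \<Omega> \<and> connected \<Omega> \<and> \<Omega> \<noteq> {} \<and> bounded \<Omega> \<and> lipschitz_boundary \<Omega>"

definition log_lap_c :: "nat \<Rightarrow> real" where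
  "log_lap_c N = pi powr (- (real N / 2)) * Gamma (real N / 2)"

definition log_lap_rho :: "nat \<Rightarrow> real" where
  "log_lap_rho N = 2 * ln 2 + Digamma (real N / 2) - euler_mascheroni"

text \<open>\<open>Digamma\<close> and \<open>euler_mascheroni\<close> are introduced in the library by a series and a limit; they
  are the logarithmic derivative of the Gamma function and minus its derivative at 1.\<close>

lemma Digamma_eq_log_deriv_Gamma:
  assumes "(x::real) > 0"
  shows "Digamma x = deriv Gamma x / Gamma x"
proof -
  have "(Gamma has_field_derivative (Gamma x * Digamma x)) (at x)"
    using assms by (intro has_field_derivative_Gamma) auto
  then have "deriv Gamma x = Gamma x * Digamma x"
    by (rule DERIV_imp_deriv)
  moreover have "Gamma x \<noteq> 0"
    using Gamma_real_pos[OF assms] by simp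
  ultimately show ?thesis by simp
qed

lemma euler_mascheroni_eq_deriv_Gamma: "euler_mascheroni = - deriv Gamma (1::real)"
  using Digamma_eq_log_deriv_Gamma[of 1] by (simp add: Digamma_1)

definition log_lap_space :: "'a::euclidean_space set \<Rightarrow> ('a \<Rightarrow> real) set" where
  "log_lap_space \<Omega> =
     {u. u \<in> borel_measurable lebesgue \<and> (\<forall>x. x \<notin> \<Omega> \<longrightarrow> u x = 0) \<and>
         (\<integral>\<^sup>+(x, y)\<in>{(x, y). norm (x - y) \<le> 1}.
            ennreal ((u x - u y)\<^sup>2 / norm (x - y) ^ DIM('a)) \<partial>lebesgue) < \<infinity>}"

definition log_lap_form :: "('a::euclidean_space \<Rightarrow> real) \<Rightarrow> ('a \<Rightarrow> real) \<Rightarrow> real" where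
  "log_lap_form u w =
     log_lap_c DIM('a) / 2 *
       (LINT (x, y):{(x, y). norm (x - y) \<le> 1}|lebesgue.
          (u x - u y) * (w x - w y) / norm (x - y) ^ DIM('a))
     - log_lap_c DIM('a) *
       (LINT (x, y):{(x, y). norm (x - y) \<ge> 1}|lebesgue.
          u x * w y / norm (x - y) ^ DIM('a))
     + log_lap_rho DIM('a) * (LINT x|lebesgue. u x * w x)"

definition L2_norm :: "'a::euclidean_space set \<Rightarrow> ('a \<Rightarrow> real) \<Rightarrow> real" where
  "L2_norm \<Omega> u = sqrt (LINT x:\<Omega>|lebesgue. (u x)\<^sup>2)"

definition log_lap_values :: "'a::euclidean_space set \<Rightarrow> real set" where
  "log_lap_values \<Omega> = {log_lap_form u u |u. u \<in> log_lap_space \<Omega> \<and> L2_norm \<Omega> u = 1}"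

text \<open>The minimum of a set of reals is rendered as its infimum; the two agree
  whenever the minimum is attained.\<close>

definition log_lap_lambda1 :: "'a::euclidean_space set \<Rightarrow> real" where
  "log_lap_lambda1 \<Omega> = Inf (log_lap_values \<Omega>)"

lemma log_lap_lambda1_eq_minimum:
  assumes "m \<in> log_lap_values \<Omega>" and "\<And>v. v \<in> log_lap_values \<Omega> \<Longrightarrow> m \<le> v"
  shows "log_lap_lambda1 \<Omega> = m"
  unfolding log_lap_lambda1_def using assms by (rule cInf_eq_minimum)

end

theory Submission
  imports Defs
begin

text \<open>The form does not increase when \<open>u\<close> is replaced by the symmetric decreasing rearrangement
  \<open>u*\<close> of \<open>|u|\<close>, which vanishes outside the ball \<open>B\<close>. For the truncated kernel
  \<open>k(z) = max(|z|, \<epsilon>) powr -N\<close>, expanding the square shows that the near part of the form plus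
  \<open>2 \<integral>\<integral> u(x) u(y) k(x - y)\<close> is a multiple of \<open>\<integral> u\<^sup>2\<close> plus twice the far part. As \<open>\<integral> u\<^sup>2\<close> is
  invariant, both parts are controlled by Riesz' inequality \<open>\<integral>\<integral> u u k \<le> \<integral>\<integral> u* u* k\<close>; then
  \<open>\<epsilon> \<rightarrow> 0\<close>. By the layer-cake formula Riesz' inequality is needed only for bounded sets \<open>A\<close>. There
  polarization (two-point rearrangement) does not decrease the double integral, and as long as
  \<open>|A* - A| \<ge> d > 0\<close> some polarization lowers this deficit by an amount that depends on \<open>d\<close> but
  not on \<open>A\<close>. So the infimum of the deficits over all competitors is \<open>0\<close>, with no compactness
  argument.\<close>

section \<open>Reflections and polarization\<close>

text \<open>The far part cannot be treated alone: its kernel vanishes for \<open>|z| < 1\<close>,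
  hence is not decreasing, and Riesz' inequality does not apply to it. Only together with the near
  part does it complete one decreasing kernel. For \<open>|z| powr -N\<close> itself the double
  integral of \<open>u(x) u(y)\<close> is infinite for every \<open>u >= 0\<close> that is not a.e.
  zero; truncation makes this term finite, so that it can be cancelled. The level sets in the
  layer-cake formula come in pairs of different size, so one reflection must serve two sets at once.
  This is harmless because polarization never increases the deficit of either set. All energies are
  \<open>ennreal\<close>-valued and compared as sums; subtraction waits until finiteness is known.
  The near energy of \<open>u*\<close> is finite because of the comparison itself, and this is what
  makes \<open>u*\<close> admissible on the ball. The comparison of two infima of sets of reals also
  requires that the set of values for \<open>\<Omega>\<close> is nonempty and that the one for the
  ball is bounded below.\<close>

lemma nn_integral_lborel_translate:
  fixes f :: "'a::euclidean_space \<Rightarrow> ennreal"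
  assumes [measurable]: "f \<in> borel_measurable borel"
  shows "(\<integral>\<^sup>+x. f (t + x) \<partial>lborel) = (\<integral>\<^sup>+x. f x \<partial>lborel)"
proof -
  have "(\<integral>\<^sup>+x. f x \<partial>lborel) = (\<integral>\<^sup>+x. f x \<partial>distr lborel borel ((+) t))"
    by (simp add: lborel_distr_plus)
  also have "\<dots> = (\<integral>\<^sup>+x. f (t + x) \<partial>lborel)"
    by (subst nn_integral_distr) auto
  finally show ?thesis by simp
qed

text \<open>Uniqueness of Haar measure: both measures are compared by integrating
  \<open>1\<^sub>A(x + y) 1\<^sub>B(x)\<close>, with \<open>B\<close> the unit ball, in either order.\<close>

lemma nn_integral_lborel_isometry:
  fixes T :: "'a::euclidean_space \<Rightarrow> 'a" and f :: "'a \<Rightarrow> ennreal"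
  assumes lin: "linear T" and iso: "\<And>x. norm (T x) = norm x"
    and f[measurable]: "f \<in> borel_measurable borel"
  shows "(\<integral>\<^sup>+x. f (T x) \<partial>lborel) = (\<integral>\<^sup>+x. f x \<partial>lborel)"
proof -
  interpret T: linear T by fact
  have [measurable]: "T \<in> borel_measurable borel"
    using linear_continuous_on[of T UNIV] lin
    by (intro borel_measurable_continuous_onI) (simp add: linear_conv_bounded_linear)
  have surj: "surj T"
  proof -
    have "inj T"
      unfolding T.inj_iff_eq_0 by (metis iso norm_eq_zero)
    then show ?thesis
      using lin linear_injective_imp_surjective by blast
  qed
  define B where "B = ball (0::'a) 1"
  define V where "V = emeasure lborel B"
  have V: "V \<noteq> 0" "V \<noteq> \<infinity>"
    unfolding V_def B_def using unit_ball_vol_pos[of "real DIM('a)"]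
    by (auto simp: emeasure_ball ennreal_eq_0_iff not_le)
  have [measurable]: "B \<in> sets borel" by (simp add: B_def)
  have ind: "indicator B (T x) = (indicator B x :: ennreal)" for x
    by (simp add: B_def indicator_def iso)
  have inv: "(\<integral>\<^sup>+y. f (x + T y) \<partial>lborel) = (\<integral>\<^sup>+y. f (T y) \<partial>lborel)" for x
  proof -
    obtain z where z: "x = T z" using surj by auto
    have "(\<integral>\<^sup>+y. f (T (z + y)) \<partial>lborel) = (\<integral>\<^sup>+y. f (T y) \<partial>lborel)"
      by (rule nn_integral_lborel_translate[where f = "\<lambda>y. f (T y)"]) simp
    then show ?thesis by (simp add: z T.add)
  qed
  have "(\<integral>\<^sup>+y. (\<integral>\<^sup>+x. f x * indicator B (x - T y) \<partial>lborel) \<partial>lborel)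
      = (\<integral>\<^sup>+y. (\<integral>\<^sup>+x. f (T y + x) * indicator B (T y + x - T y) \<partial>lborel) \<partial>lborel)"
    by (intro nn_integral_cong nn_integral_lborel_translate[symmetric]) simp
  also have "\<dots> = (\<integral>\<^sup>+y. (\<integral>\<^sup>+x. f (x + T y) * indicator B x \<partial>lborel) \<partial>lborel)"
    by (simp add: add.commute)
  also have "\<dots> = (\<integral>\<^sup>+x. (\<integral>\<^sup>+y. f (x + T y) * indicator B x \<partial>lborel) \<partial>lborel)"
    by (rule lborel_pair.Fubini') simp
  also have "\<dots> = (\<integral>\<^sup>+x. (\<integral>\<^sup>+y. f (T y) \<partial>lborel) * indicator B x \<partial>lborel)"
    by (intro nn_integral_cong) (simp add: nn_integral_multc inv)
  also have "\<dots> = (\<integral>\<^sup>+y. f (T y) \<partial>lborel) * V"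
    by (simp add: nn_integral_cmult V_def)
  finally have 1: "(\<integral>\<^sup>+y. (\<integral>\<^sup>+x. f x * indicator B (x - T y) \<partial>lborel) \<partial>lborel)
      = (\<integral>\<^sup>+y. f (T y) \<partial>lborel) * V" .
  have "(\<integral>\<^sup>+y. (\<integral>\<^sup>+x. f x * indicator B (x - T y) \<partial>lborel) \<partial>lborel)
     = (\<integral>\<^sup>+x. (\<integral>\<^sup>+y. f x * indicator B (x - T y) \<partial>lborel) \<partial>lborel)"
    by (rule lborel_pair.Fubini') simp
  also have "\<dots> = (\<integral>\<^sup>+x. f x * V \<partial>lborel)"
  proof (rule nn_integral_cong)
    fix x
    obtain z where z: "x = T z" using surj by auto
    have "(\<integral>\<^sup>+y. indicator B (x - T y) \<partial>lborel) = (\<integral>\<^sup>+y. indicator B (z - y) \<partial>lborel)"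
      by (simp add: z ind flip: T.diff)
    also have "\<dots> = (\<integral>\<^sup>+y. indicator B (z - (z + y)) \<partial>lborel)"
      by (subst nn_integral_lborel_translate[symmetric, where t = z]) simp_all
    also have "\<dots> = (\<integral>\<^sup>+y. indicator B y \<partial>lborel)"
      by (simp add: B_def indicator_def)
    also have "\<dots> = V"
      by (simp add: V_def)
    finally show "(\<integral>\<^sup>+y. f x * indicator B (x - T y) \<partial>lborel) = f x * V"
      by (simp add: nn_integral_cmult)
  qed
  also have "\<dots> = (\<integral>\<^sup>+x. f x \<partial>lborel) * V"
    by (simp add: nn_integral_multc)
  finally show ?thesis
    using 1 V by (simp add: mult.commute[of _ V] ennreal_mult_cancel_left)
qed

text \<open>\<open>reflect v\<close> is the reflection in the bisector of \<open>0\<close> and \<open>v\<close>; \<open>side v\<close> is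
  nonnegative exactly on the half-space that contains \<open>0\<close>.\<close>

definition side :: "'a::euclidean_space \<Rightarrow> 'a \<Rightarrow> real" where
  "side v x = 1 - 2 * (x \<bullet> v) / (v \<bullet> v)"

definition reflect :: "'a::euclidean_space \<Rightarrow> 'a \<Rightarrow> 'a" where
  "reflect v x = x + side v x *\<^sub>R v"

lemma reflect_measurable2 [measurable]:
  assumes [measurable]: "f \<in> borel_measurable M" "g \<in> borel_measurable M"
  shows "(\<lambda>x. reflect (f x) (g x)) \<in> borel_measurable M"
  unfolding reflect_def side_def by measurable

lemma side_reflect: "v \<noteq> 0 \<Longrightarrow> side v (reflect v x) = - side v x"
  by (simp add: reflect_def side_def inner_add_left field_simps)

lemma reflect_reflect [simp]: "v \<noteq> 0 \<Longrightarrow> reflect v (reflect v x) = x"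
  by (subst reflect_def) (simp add: side_reflect, simp add: reflect_def)

text \<open>Since \<open>side v\<close> is affine, the change of the squared distance factors, and
  its sign tells whether \<open>x\<close> and \<open>y\<close> lie on the same side of the mirror.
  The comparisons of distances and norms in the next lemmas are read off from this identity.\<close>

lemma reflect_diff_square:
  assumes "v \<noteq> 0"
  shows "(norm (x - reflect v y))\<^sup>2 = (norm (x - y))\<^sup>2 + (v \<bullet> v) * (side v x * side v y)"
proof -
  have v: "v \<bullet> v \<noteq> 0" using assms by simp
  have *: "2 * (z \<bullet> v) = (1 - side v z) * (v \<bullet> v)" for z
    using v by (simp add: side_def)
  have "(norm (x - reflect v y))\<^sup>2 = (norm (x - y - side v y *\<^sub>R v))\<^sup>2"
    by (simp add: reflect_def algebra_simps)
  also have "\<dots> = (norm (x - y))\<^sup>2 - side v y * (2 * (x \<bullet> v) - 2 * (y \<bullet> v)) + side v y * side v y * (v \<bullet> v)"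
    by (simp add: power2_norm_eq_inner inner_diff_right inner_commute algebra_simps)
  also have "\<dots> = (norm (x - y))\<^sup>2 + (v \<bullet> v) * (side v x * side v y)"
    unfolding * by (simp add: algebra_simps)
  finally show ?thesis .
qed

lemma norm_reflect_square:
  assumes "v \<noteq> 0"
  shows "(norm (reflect v x))\<^sup>2 = (norm x)\<^sup>2 + (v \<bullet> v) * side v x"
  using reflect_diff_square[OF assms, of 0 x] by (simp add: side_def[of v 0])

lemma norm_le_reflect_iff:
  assumes "v \<noteq> 0"
  shows "norm x \<le> norm (reflect v x) \<longleftrightarrow> 0 \<le> side v x"
proof -
  have "norm x \<le> norm (reflect v x) \<longleftrightarrow> (norm x)\<^sup>2 \<le> (norm (reflect v x))\<^sup>2"
    by (simp add: abs_le_square_iff[symmetric])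
  moreover have "v \<bullet> v > 0" using assms by simp
  ultimately show ?thesis
    unfolding norm_reflect_square[OF assms] by (auto simp: zero_le_mult_iff)
qed

text \<open>Equal norms force \<open>side v x = 0\<close>, that is, \<open>x\<close> lies on the
  mirror. This settles the ties in \<open>polarize\<close>, where a point and its image both count
  as the nearer one.\<close>

lemma reflect_eq_self:
  assumes "v \<noteq> 0" "norm x = norm (reflect v x)"
  shows "reflect v x = x"
  using norm_reflect_square[OF assms(1), of x] assms by (simp add: reflect_def)

lemma dist_reflect_reflect:
  assumes "v \<noteq> 0" shows "norm (reflect v x - reflect v y) = norm (x - y)"
proof -
  have "(norm (reflect v x - y))\<^sup>2 = (norm (x - y))\<^sup>2 + (v \<bullet> v) * (side v y * side v x)"
    using reflect_diff_square[OF assms, of y x] by (simp add: norm_minus_commute)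
  then have "(norm (reflect v x - reflect v y))\<^sup>2 = (norm (x - y))\<^sup>2"
    unfolding reflect_diff_square[OF assms, of "reflect v x" y]
    using assms by (simp add: side_reflect)
  then show ?thesis by simp
qed

lemma norm_diff_reflect_swap:
  "v \<noteq> 0 \<Longrightarrow> norm (reflect v x - y) = norm (x - reflect v y)"
  using dist_reflect_reflect[of v x "reflect v y"] by simp

lemma norm_diff_reflect_same_side:
  assumes "v \<noteq> 0" "norm x \<le> norm (reflect v x) \<longleftrightarrow> norm y \<le> norm (reflect v y)"
  shows "norm (x - y) \<le> norm (x - reflect v y)"
proof -
  have "0 \<le> side v x * side v y"
    using assms(2) unfolding norm_le_reflect_iff[OF assms(1)] by (auto simp: zero_le_mult_iff)
  then have "(norm (x - y))\<^sup>2 \<le> (norm (x - reflect v y))\<^sup>2"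
    unfolding reflect_diff_square[OF assms(1), of x y] by simp
  then show ?thesis by (simp add: abs_le_square_iff[symmetric])
qed

lemma norm_diff_reflect_opposite_side:
  assumes "v \<noteq> 0" "norm x \<le> norm (reflect v x) \<longleftrightarrow> \<not> norm y \<le> norm (reflect v y)"
  shows "norm (x - reflect v y) \<le> norm (x - y)"
proof -
  have "side v x * side v y \<le> 0"
    using assms(2) unfolding norm_le_reflect_iff[OF assms(1)] by (auto simp: mult_le_0_iff)
  then have "(norm (x - reflect v y))\<^sup>2 \<le> (norm (x - y))\<^sup>2"
    unfolding reflect_diff_square[OF assms(1), of x y]
    by (simp add: mult_nonneg_nonpos)
  then show ?thesis by (simp add: abs_le_square_iff[symmetric])
qed

lemma nn_integral_reflect:
  fixes f :: "'a::euclidean_space \<Rightarrow> ennreal"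
  assumes v: "v \<noteq> 0" and [measurable]: "f \<in> borel_measurable borel"
  shows "(\<integral>\<^sup>+x. f (reflect v x) \<partial>lborel) = (\<integral>\<^sup>+x. f x \<partial>lborel)"
proof -
  \<comment> \<open>\<open>reflect v\<close> sends 0 to \<open>v\<close>; without this translation
    it is the linear Householder reflection.\<close>
  define T where "T x = reflect v x - v" for x :: 'a
  have T: "T x = x - (2 * (x \<bullet> v) / (v \<bullet> v)) *\<^sub>R v" for x
    by (simp add: T_def reflect_def side_def algebra_simps)
  have lin: "linear T"
    by (rule linearI) (simp_all add: T inner_add_left algebra_simps add_divide_distrib)
  have "norm (T x) = norm x" for x
    using dist_reflect_reflect[OF v, of x 0] by (simp add: T_def reflect_def side_def)
  then have "(\<integral>\<^sup>+x. f (v + T x) \<partial>lborel) = (\<integral>\<^sup>+x. f (v + x) \<partial>lborel)"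
    by (intro nn_integral_lborel_isometry[OF lin, where f = "\<lambda>x. f (v + x)"]) auto
  then show ?thesis
    by (simp add: T_def nn_integral_lborel_translate)
qed

text \<open>The half-space is encoded by a comparison of norms, so that membership of a point and of
  its image in a ball around 0 can be compared directly. For \<open>v = 0\<close> the result is
  \<open>A\<close> itself.\<close>

definition polarize :: "'a::euclidean_space \<Rightarrow> 'a set \<Rightarrow> 'a set" where
  "polarize v A = {x. if norm x \<le> norm (reflect v x) then x \<in> A \<or> reflect v x \<in> A
                      else x \<in> A \<and> reflect v x \<in> A}"

lemma sets_polarize [measurable]:
  assumes [measurable]: "A \<in> sets borel"
  shows "polarize v A \<in> sets borel"
proof -
  have "Measurable.pred borel (\<lambda>x. x \<in> polarize v A)"
    unfolding polarize_def mem_Collect_eq by measurable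
  then show ?thesis by (simp add: pred_def)
qed

lemma polarize_subset_ball:
  assumes "A \<subseteq> ball 0 M" shows "polarize v A \<subseteq> ball 0 M"
  using assms by (force simp: polarize_def split: if_splits)

text \<open>By reflection invariance, twice a measure is the integral of the indicator at
  \<open>x\<close> plus the indicator at its image. Within such a pair polarization only changes
  which of the points is chosen, not how many.\<close>

lemma emeasure_polarize:
  assumes v: "v \<noteq> 0" and [measurable]: "A \<in> sets borel"
  shows "emeasure lborel (polarize v A) = emeasure lborel A"
proof -
  have *: "2 * emeasure lborel B = (\<integral>\<^sup>+x. indicator B x + indicator B (reflect v x) \<partial>lborel)"
    if [measurable]: "B \<in> sets borel" for B
    by (subst nn_integral_add) (auto simp: nn_integral_reflect[OF v, of "indicator B"] mult_2)
  have "indicator (polarize v A) x + indicator (polarize v A) (reflect v x)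
       = (indicator A x + indicator A (reflect v x) :: ennreal)" for x
    using v reflect_eq_self[OF v, of x]
    by (cases "norm x" "norm (reflect v x)" rule: linorder_cases)
      (auto simp: polarize_def indicator_def)
  then have "2 * emeasure lborel (polarize v A) = 2 * emeasure lborel A"
    by (simp add: *)
  then show ?thesis
    by (simp add: ennreal_mult_cancel_left)
qed

text \<open>The two sides differ only if \<open>a\<close> and \<open>b\<close> each hold at exactly
  one of the two positions, and at different ones; then \<open>q\<close> is replaced by
  \<open>p\<close>.\<close>

lemma two_point_rearrangement:
  fixes p q :: real
  assumes "q \<le> p"
  shows "(of_bool a\<^sub>0 * of_bool b\<^sub>0 + of_bool a\<^sub>1 * of_bool b\<^sub>1) * p
           + (of_bool a\<^sub>0 * of_bool b\<^sub>1 + of_bool a\<^sub>1 * of_bool b\<^sub>0) * q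
       \<le> (of_bool (a\<^sub>0 \<or> a\<^sub>1) * of_bool (b\<^sub>0 \<or> b\<^sub>1) + of_bool (a\<^sub>0 \<and> a\<^sub>1) * of_bool (b\<^sub>0 \<and> b\<^sub>1)) * p
           + (of_bool (a\<^sub>0 \<or> a\<^sub>1) * of_bool (b\<^sub>0 \<and> b\<^sub>1) + of_bool (a\<^sub>0 \<and> a\<^sub>1) * of_bool (b\<^sub>0 \<or> b\<^sub>1)) * q"
  using assms by (cases a\<^sub>0; cases a\<^sub>1; cases b\<^sub>0; cases b\<^sub>1) simp_all

lemma in_polarize_near:
  assumes "v \<noteq> 0" "norm x \<le> norm (reflect v x)"
  shows "x \<in> polarize v A \<longleftrightarrow> x \<in> A \<or> reflect v x \<in> A"
    and "reflect v x \<in> polarize v A \<longleftrightarrow> x \<in> A \<and> reflect v x \<in> A"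
  using assms reflect_eq_self[of v x] by (auto simp: polarize_def not_le)

lemma in_polarize_far:
  assumes "v \<noteq> 0" "\<not> norm x \<le> norm (reflect v x)"
  shows "x \<in> polarize v A \<longleftrightarrow> x \<in> A \<and> reflect v x \<in> A"
    and "reflect v x \<in> polarize v A \<longleftrightarrow> x \<in> A \<or> reflect v x \<in> A"
  using assms by (auto simp: polarize_def)

text \<open>If \<open>x\<close> and \<open>y\<close> lie on the same side,
  \<open>norm (x - y)\<close> is the smaller of the two distances and \<open>k\<close> of it takes
  the role of \<open>p\<close> in \<open>two_point_rearrangement\<close>; on opposite sides it is
  \<open>norm (x - y')\<close>. In each pair the point nearer to 0 is listed first, which accounts
  for the four instances.\<close>

lemma polarize_pointwise:
  fixes k :: "real \<Rightarrow> real" and v :: "'a::euclidean_space"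
    and A B :: "'a set" and x y :: 'a
  assumes v: "v \<noteq> 0" and k: "antimono k"
  defines "a \<equiv> indicator A :: 'a \<Rightarrow> real" and "b \<equiv> indicator B :: 'a \<Rightarrow> real"
    and "a' \<equiv> indicator (polarize v A) :: 'a \<Rightarrow> real"
    and "b' \<equiv> indicator (polarize v B) :: 'a \<Rightarrow> real"
    and "x' \<equiv> reflect v x" and "y' \<equiv> reflect v y"
  shows "(a x * b y + a x' * b y') * k (norm (x - y)) + (a x * b y' + a x' * b y) * k (norm (x - y'))
       \<le> (a' x * b' y + a' x' * b' y') * k (norm (x - y)) + (a' x * b' y' + a' x' * b' y) * k (norm (x - y'))"
proof -
  have same: "k (norm (x - y')) \<le> k (norm (x - y))" if "norm x \<le> norm x' \<longleftrightarrow> norm y \<le> norm y'"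
    using antimonoD[OF k norm_diff_reflect_same_side[OF v]] that by (simp add: x'_def y'_def)
  have opp: "k (norm (x - y)) \<le> k (norm (x - y'))" if "norm x \<le> norm x' \<longleftrightarrow> \<not> norm y \<le> norm y'"
    using antimonoD[OF k norm_diff_reflect_opposite_side[OF v]] that by (simp add: x'_def y'_def)
  note ind = a_def b_def a'_def b'_def indicator_def
  note near = in_polarize_near[OF v, of x, folded x'_def] in_polarize_near[OF v, of y, folded y'_def]
  note far = in_polarize_far[OF v, of x, folded x'_def] in_polarize_far[OF v, of y, folded y'_def]
  show ?thesis
  proof (cases "norm x \<le> norm x'"; cases "norm y \<le> norm y'")
    assume n: "norm x \<le> norm x'" "norm y \<le> norm y'"
    show ?thesis
      unfolding ind near(1,2)[OF n(1)] near(3,4)[OF n(2)]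
      using two_point_rearrangement[OF same, of "x \<in> A" "y \<in> B" "x' \<in> A" "y' \<in> B"] n by argo
  next
    assume n: "norm x \<le> norm x'" "\<not> norm y \<le> norm y'"
    show ?thesis
      unfolding ind near(1,2)[OF n(1)] far(3,4)[OF n(2)]
      using two_point_rearrangement[OF opp, of "x \<in> A" "y' \<in> B" "x' \<in> A" "y \<in> B"] n
      by (simp only: disj_commute[of "y' \<in> B"] conj_commute[of "y' \<in> B"]) argo
  next
    assume n: "\<not> norm x \<le> norm x'" "norm y \<le> norm y'"
    show ?thesis
      unfolding ind far(1,2)[OF n(1)] near(3,4)[OF n(2)]
      using two_point_rearrangement[OF opp, of "x' \<in> A" "y \<in> B" "x \<in> A" "y' \<in> B"] n
      by (simp only: disj_commute[of "x' \<in> A"] conj_commute[of "x' \<in> A"]) argo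
  next
    assume n: "\<not> norm x \<le> norm x'" "\<not> norm y \<le> norm y'"
    show ?thesis
      unfolding ind far(1,2)[OF n(1)] far(3,4)[OF n(2)]
      using two_point_rearrangement[OF same, of "x' \<in> A" "y' \<in> B" "x \<in> A" "y \<in> B"] n
      by (simp only: disj_commute[of "x' \<in> A"] conj_commute[of "x' \<in> A"]
          disj_commute[of "y' \<in> B"] conj_commute[of "y' \<in> B"]) argo
  qed
qed

definition riesz :: "(real \<Rightarrow> real) \<Rightarrow> ('a::euclidean_space \<Rightarrow> real) \<Rightarrow> ('a \<Rightarrow> real) \<Rightarrow> ennreal" where
  "riesz k f g = (\<integral>\<^sup>+x. \<integral>\<^sup>+y. ennreal (f x * g y * k (norm (x - y))) \<partial>lborel \<partial>lborel)"

text \<open>Replacing \<open>x\<close>, \<open>y\<close> or both by their images does not change the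
  double integral. The sum over the four choices involves only the two distances
  \<open>norm (x - y)\<close> and \<open>norm (x - reflect v y)\<close>, so the pointwise inequality
  applies to it.\<close>

lemma riesz_polarize:
  fixes A B :: "'a::euclidean_space set"
  assumes v: "v \<noteq> 0" and k: "antimono k" and k0: "\<And>x. 0 \<le> k x"
    and [measurable]: "k \<in> borel_measurable borel" "A \<in> sets borel" "B \<in> sets borel"
  shows "riesz k (indicator A) (indicator B) \<le> riesz k (indicator (polarize v A)) (indicator (polarize v B))"
proof -
  define F where "F A B x y = (indicator A x * indicator B y + indicator A (reflect v x) * indicator B (reflect v y)) * k (norm (x - y))
           + (indicator A x * indicator B (reflect v y) + indicator A (reflect v x) * indicator B y) * k (norm (x - reflect v y))"
    for A B :: "'a set" and x y :: 'a
  have *: "4 * riesz k (indicator A) (indicator B) = (\<integral>\<^sup>+x. \<integral>\<^sup>+y. ennreal (F A B x y) \<partial>lborel \<partial>lborel)"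
    if [measurable]: "A \<in> sets borel" "B \<in> sets borel" for A B :: "'a set"
  proof -
    define f where "f x y = ennreal (indicator A x * indicator B y * k (norm (x - y)))" for x y :: 'a
    have [measurable]: "(\<lambda>(x, y). f x y) \<in> borel_measurable (borel \<Otimes>\<^sub>M borel)"
      unfolding f_def by measurable
    have 0: "(\<integral>\<^sup>+y. f x (reflect v y) \<partial>lborel) = (\<integral>\<^sup>+y. f x y \<partial>lborel)" for x
      by (rule nn_integral_reflect[OF v]) measurable
    have 1: "(\<integral>\<^sup>+x. \<integral>\<^sup>+y. f (reflect v x) y \<partial>lborel \<partial>lborel) = (\<integral>\<^sup>+x. \<integral>\<^sup>+y. f x y \<partial>lborel \<partial>lborel)"
      by (rule nn_integral_reflect[OF v]) measurable
    have "ennreal (F A B x y) = f x y + f x (reflect v y) + f (reflect v x) y + f (reflect v x) (reflect v y)" for x y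
      unfolding f_def F_def using k0 v
      by (simp add: dist_reflect_reflect norm_diff_reflect_swap distrib_right flip: ennreal_plus)
    then have "(\<integral>\<^sup>+x. \<integral>\<^sup>+y. ennreal (F A B x y) \<partial>lborel \<partial>lborel) =
      (\<integral>\<^sup>+x. (\<integral>\<^sup>+y. f x y \<partial>lborel) + (\<integral>\<^sup>+y. f x (reflect v y) \<partial>lborel) + (\<integral>\<^sup>+y. f (reflect v x) y \<partial>lborel)
        + (\<integral>\<^sup>+y. f (reflect v x) (reflect v y) \<partial>lborel) \<partial>lborel)"
      by (simp add: nn_integral_add)
    also have "\<dots> = 4 * (\<integral>\<^sup>+x. \<integral>\<^sup>+y. f x y \<partial>lborel \<partial>lborel)"
      unfolding 0 by (simp add: nn_integral_add 1) (simp add: add.assoc flip: mult_2 distrib_right)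
    finally show ?thesis
      by (simp add: riesz_def f_def)
  qed
  have "4 * riesz k (indicator A) (indicator B) \<le> 4 * riesz k (indicator (polarize v A)) (indicator (polarize v B))"
    unfolding *[OF assms(5,6)] *[OF sets_polarize[OF assms(5)] sets_polarize[OF assms(6)]]
    unfolding F_def by (intro nn_integral_mono ennreal_leI polarize_pointwise[OF v k])
  then show ?thesis
    by (simp add: ennreal_mult_le_mult_iff)
qed

section \<open>Measure gained by a polarization\<close>

lemma emeasure_UN_countable_le:
  assumes [measurable]: "\<And>i. i \<in> I \<Longrightarrow> X i \<in> sets M" and I: "countable I"
  shows "emeasure M (\<Union>i\<in>I. X i) \<le> (\<integral>\<^sup>+i. emeasure M (X i) \<partial>count_space I)"
proof -
  have "emeasure M (\<Union>i\<in>I. X i) = (\<integral>\<^sup>+x. indicator (\<Union>i\<in>I. X i) x \<partial>M)"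
    using assms by (intro nn_integral_indicator[symmetric] sets.countable_UN') auto
  also have "\<dots> \<le> (\<integral>\<^sup>+x. (\<integral>\<^sup>+i. indicator (X i) x \<partial>count_space I) \<partial>M)"
  proof (rule nn_integral_mono)
    fix x
    show "indicator (\<Union>i\<in>I. X i) x \<le> (\<integral>\<^sup>+i. indicator (X i) x \<partial>count_space I)"
    proof (cases "x \<in> (\<Union>i\<in>I. X i)")
      case True
      then obtain j where j: "j \<in> I" "x \<in> X j" by auto
      have "indicator (X j) x \<le> (\<integral>\<^sup>+i. indicator (X i) x \<partial>count_space I)"
        using j(1) by (rule nn_integral_ge_point)
      with True j show ?thesis by simp
    qed simp
  qed
  also have "\<dots> = (\<integral>\<^sup>+i. (\<integral>\<^sup>+x. indicator (X i) x \<partial>M) \<partial>count_space I)"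
    using I by (intro nn_integral_count_space_nn_integral) auto
  also have "\<dots> = (\<integral>\<^sup>+i. emeasure M (X i) \<partial>count_space I)"
    by (intro nn_integral_cong) simp
  finally show ?thesis .
qed

text \<open>Cover the domain by cubes of total volume close to that of \<open>W\<close>; the image of a cube of
  side \<open>s\<close> lies in a cube of side \<open>2 L N s\<close>.\<close>

lemma emeasure_lipschitz_image_le:
  fixes f :: "'a::euclidean_space \<Rightarrow> 'a"
  assumes "open U" and WU: "W \<subseteq> U" and W: "W \<in> sets borel" "bounded W"
    and lip: "\<And>x y. x \<in> U \<Longrightarrow> y \<in> U \<Longrightarrow> norm (f x - f y) \<le> L * norm (x - y)" and L: "0 < L"
    and E: "E \<in> sets borel" "E \<subseteq> f ` W"
  shows "emeasure lborel E \<le> ennreal ((2 * L * DIM('a)) ^ DIM('a)) * emeasure lborel W"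
proof (rule ennreal_le_epsilon)
  define C where "C = (2 * L * DIM('a)) ^ DIM('a)"
  have C: "C > 0" using L by (simp add: C_def)
  fix e :: real assume e: "e > 0"
  have eC: "0 < e / C" using e C by simp
  \<comment> \<open>The excess volume \<open>e / C\<close> becomes \<open>e\<close> after
    multiplication by the factor \<open>C\<close>.\<close>
  obtain O' where O': "open O'" "W \<subseteq> O'" "emeasure lborel (O' - W) < e / C"
    using outer_regular_lborel[OF W(1) eC] by metis
  define G where "G = U \<inter> O'"
  have G: "open G" "W \<subseteq> G" using O' \<open>open U\<close> WU by (auto simp: G_def)
  have "emeasure lborel G \<le> emeasure lborel (W \<union> (O' - W))"
    using O' G W by (intro emeasure_mono) (auto simp: G_def)
  also have "\<dots> \<le> emeasure lborel W + emeasure lborel (O' - W)"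
    using O' W by (intro emeasure_subadditive) auto
  also have "\<dots> \<le> emeasure lborel W + e / C"
    using O' by (intro add_mono) auto
  finally have eG: "emeasure lborel G \<le> emeasure lborel W + e / C" .
  obtain c where c: "c > 0" "W \<subseteq> cbox (- c *\<^sub>R One) (c *\<^sub>R One)"
  proof -
    obtain b where b: "b > 0" "\<And>x. x \<in> W \<Longrightarrow> norm x \<le> b"
      using W(2) bounded_pos by blast
    have "x \<in> cbox (- b *\<^sub>R One) (b *\<^sub>R One)" if "x \<in> W" for x
      unfolding mem_box
    proof
      fix i :: 'a assume i: "i \<in> Basis"
      have "\<bar>x \<bullet> i\<bar> \<le> b"
        using Basis_le_norm[OF i, of x] b(2)[OF that] by linarith
      then show "(- b *\<^sub>R One) \<bullet> i \<le> x \<bullet> i \<and> x \<bullet> i \<le> (b *\<^sub>R One) \<bullet> i"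
        using i by (simp add: abs_le_iff)
    qed
    with b show ?thesis using that by blast
  qed
  \<comment> \<open>The covering lemma places each cube inside \<open>g x\<close> for some
    \<open>x\<close> in \<open>W\<close>. With the value \<open>G\<close> there, every cube lies in
    \<open>G\<close>: thus in \<open>U\<close>, where the Lipschitz bound holds, and in a set of
    nearly the volume of \<open>W\<close>.\<close>
  define g where "g x = (if x \<in> G then G else ball x 1)" for x
  have ga: "gauge g" using G by (auto simp: gauge_def g_def)
  have ne: "box (- c *\<^sub>R One) (c *\<^sub>R One :: 'a) \<noteq> {}"
    using c by (simp add: box_ne_empty)
  obtain D where D: "countable D" "\<Union>D \<subseteq> cbox (- c *\<^sub>R One) (c *\<^sub>R One)"
    "\<And>K. K \<in> D \<Longrightarrow> interior K \<noteq> {} \<and> (\<exists>c d. K = cbox c d)"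
    "pairwise (\<lambda>A B. interior A \<inter> interior B = {}) D"
    "\<And>K. K \<in> D \<Longrightarrow> \<exists>x \<in> W \<inter> K. K \<subseteq> g x"
    "\<And>u v. cbox u v \<in> D \<Longrightarrow> \<exists>n. \<forall>i \<in> Basis. v \<bullet> i - u \<bullet> i = ((c *\<^sub>R One) \<bullet> i - (- c *\<^sub>R One) \<bullet> i) / 2^n"
    "W \<subseteq> \<Union>D"
    by (rule covering_lemma[OF c(2) ne ga]) (rule that; (assumption | meson))
  have KG: "K \<subseteq> G" if "K \<in> D" for K
  proof -
    obtain x where "x \<in> W" "K \<subseteq> g x" using D(5)[OF \<open>K \<in> D\<close>] by blast
    moreover from this(1) have "g x = G" using G(2) by (auto simp: g_def)
    ultimately show ?thesis by simp
  qed
  \<comment> \<open>The volume of a cube is written as that of its interior, because only the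
    interiors of the cubes in \<open>D\<close> are disjoint and can be summed.\<close>
  have "\<exists>Q. f ` K \<subseteq> Q \<and> Q \<in> sets borel \<and> emeasure lborel Q = C * emeasure lborel (interior K)" if K: "K \<in> D" for K
  proof -
    obtain u v where uv: "K = cbox u v" "box u v \<noteq> {}"
      using D(3)[OF K] by (metis interior_cbox)
    obtain n where n: "\<And>i. i \<in> Basis \<Longrightarrow> v \<bullet> i - u \<bullet> i = 2 * c / 2 ^ n"
      using D(6)[of u v] K uv(1) by (auto simp: algebra_simps)
    define s where "s = 2 * c / 2 ^ n"
    have s: "s > 0" "\<And>i. i \<in> Basis \<Longrightarrow> v \<bullet> i - u \<bullet> i = s"
      using c n by (auto simp: s_def)
    define Q where "Q = cbox (f u - (L * DIM('a) * s) *\<^sub>R One) (f u + (L * DIM('a) * s) *\<^sub>R One)"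
    have uK: "u \<in> K" using uv by (auto simp: mem_box box_ne_empty less_imp_le)
    have "f z \<in> Q" if z: "z \<in> K" for z
    proof -
      have "norm (z - u) \<le> (\<Sum>i\<in>Basis. \<bar>(z - u) \<bullet> i\<bar>)" by (rule norm_le_l1)
      also have "\<dots> \<le> (\<Sum>i\<in>(Basis::'a set). s)"
      proof (rule sum_mono)
        fix i :: 'a assume i: "i \<in> Basis"
        then have "u \<bullet> i \<le> z \<bullet> i" "z \<bullet> i \<le> v \<bullet> i"
          using z by (simp_all add: uv(1) mem_box)
        then show "\<bar>(z - u) \<bullet> i\<bar> \<le> s"
          using s(2)[OF i] by (simp add: inner_diff_left)
      qed
      finally have "norm (z - u) \<le> DIM('a) * s" by simp
      then have "L * norm (z - u) \<le> L * (DIM('a) * s)"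
        using L by (intro mult_left_mono) auto
      moreover have "norm (f z - f u) \<le> L * norm (z - u)"
        using KG[OF K] z uK by (intro lip) (auto simp: G_def)
      ultimately have "norm (f z - f u) \<le> L * DIM('a) * s" by simp
      note le = this
      show ?thesis
        unfolding Q_def mem_box
      proof
        fix i :: 'a assume i: "i \<in> Basis"
        have "\<bar>f z \<bullet> i - f u \<bullet> i\<bar> \<le> L * DIM('a) * s"
          using Basis_le_norm[OF i, of "f z - f u"] le by (simp add: inner_diff_left)
        then show "(f u - (L * DIM('a) * s) *\<^sub>R One) \<bullet> i \<le> f z \<bullet> i \<and>
            f z \<bullet> i \<le> (f u + (L * DIM('a) * s) *\<^sub>R One) \<bullet> i"
          using i by (simp add: inner_diff_left inner_add_left abs_le_iff)
      qed
    qed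
    moreover have "emeasure lborel Q = C * emeasure lborel (interior K)"
    proof -
      have "emeasure lborel Q = (\<Prod>b\<in>(Basis::'a set). 2 * (L * DIM('a) * s))"
        unfolding Q_def using L s by (subst emeasure_lborel_cbox) (auto simp: algebra_simps)
      also have "\<dots> = C * s ^ DIM('a)"
        using L s by (simp add: C_def power_mult_distrib ennreal_power)
      also have "\<dots> = C * ennreal (s ^ DIM('a))"
        using C s by (simp add: ennreal_mult)
      also have "ennreal (s ^ DIM('a)) = emeasure lborel (interior K)"
      proof -
        have "(\<Prod>b\<in>Basis. (v - u) \<bullet> b) = (\<Prod>b\<in>(Basis::'a set). s)"
          using s by (intro prod.cong) (auto simp: inner_diff_left)
        then show ?thesis
          using uv by (simp add: interior_cbox emeasure_lborel_box_eq box_ne_empty less_imp_le)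
      qed
      finally show ?thesis .
    qed
    ultimately show ?thesis by (intro exI[of _ Q]) (auto simp: Q_def)
  qed
  then obtain Q where Q: "\<And>K. K \<in> D \<Longrightarrow> f ` K \<subseteq> Q K" "\<And>K. K \<in> D \<Longrightarrow> Q K \<in> sets borel"
      "\<And>K. K \<in> D \<Longrightarrow> emeasure lborel (Q K) = C * emeasure lborel (interior K)" by metis
  have "emeasure lborel E \<le> emeasure lborel (\<Union>K\<in>D. Q K)"
  proof (rule emeasure_mono)
    show "E \<subseteq> (\<Union>K\<in>D. Q K)" using E(2) D(7) Q(1) by blast
    show "(\<Union>K\<in>D. Q K) \<in> sets lborel" using D(1) Q(2) by (intro sets.countable_UN') auto
  qed
  also have "\<dots> \<le> (\<integral>\<^sup>+K. emeasure lborel (Q K) \<partial>count_space D)"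
    using D(1) Q(2) by (intro emeasure_UN_countable_le) auto
  also have "\<dots> = C * (\<integral>\<^sup>+K. emeasure lborel (interior K) \<partial>count_space D)"
    by (subst nn_integral_cmult[symmetric]) (auto intro!: nn_integral_cong simp: Q)
  also have "(\<integral>\<^sup>+K. emeasure lborel (interior K) \<partial>count_space D) = emeasure lborel (\<Union>K\<in>D. interior K)"
    using D(1,4) by (subst emeasure_UN_countable) (auto simp: disjoint_family_on_def pairwise_def)
  also have "\<dots> \<le> emeasure lborel G"
  proof (rule emeasure_mono)
    show "(\<Union>K\<in>D. interior K) \<subseteq> G" using KG interior_subset by blast
  qed (use G in auto)
  also note eG
  also have "C * (emeasure lborel W + e / C) = C * emeasure lborel W + e"
    using C e by (simp add: distrib_left flip: ennreal_mult)
  finally show "emeasure lborel E \<le> ennreal ((2 * L * DIM('a)) ^ DIM('a)) * emeasure lborel W + ennreal e"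
    by (simp add: C_def mult_left_mono)
qed


section \<open>Dependence of a reflection on its parameter, and the effect of a reflection on the
  deficit\<close>

lemma norm_sgn_diff_le:
  fixes v w :: "'a::real_inner"
  assumes "0 < h" "h \<le> norm v" "h \<le> norm w"
  shows "norm (sgn v - sgn w) \<le> 2 / h * norm (v - w)"
proof -
  have nz: "norm v > 0" "norm w > 0" using assms by auto
  have "sgn v - sgn w = (1 / norm v) *\<^sub>R (v - w) + (1 / norm v - 1 / norm w) *\<^sub>R w"
    by (simp add: sgn_div_norm algebra_simps divide_inverse)
  then have "norm (sgn v - sgn w) \<le> norm (v - w) / norm v + \<bar>1 / norm v - 1 / norm w\<bar> * norm w"
    using norm_triangle_ineq[of "(1 / norm v) *\<^sub>R (v - w)" "(1 / norm v - 1 / norm w) *\<^sub>R w"] by simp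
  also have "\<bar>1 / norm v - 1 / norm w\<bar> * norm w = \<bar>(1 / norm v - 1 / norm w) * norm w\<bar>"
    by (simp add: abs_mult)
  also have "(1 / norm v - 1 / norm w) * norm w = (norm w - norm v) / norm v"
    using nz by (simp add: field_simps)
  also have "\<bar>(norm w - norm v) / norm v\<bar> \<le> norm (v - w) / norm v"
    using norm_triangle_ineq3[of w v] by (simp add: divide_right_mono norm_minus_commute)
  finally have "norm (sgn v - sgn w) \<le> 2 * (norm (v - w) / norm v)" by simp
  also have "norm (v - w) / norm v \<le> norm (v - w) / h"
    using assms by (intro divide_left_mono mult_pos_pos) auto
  finally show ?thesis by simp
qed

text \<open>With the unit normal \<open>n = sgn v\<close>, the image of \<open>x\<close> is
  \<open>x + v - 2 (x . n) n\<close>. The translation contributes the constant 1; the product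
  contributes \<open>4 * norm x\<close> times the Lipschitz constant \<open>2 / h\<close> of
  \<open>sgn\<close>.\<close>

lemma reflect_lipschitz:
  fixes v w x :: "'a::euclidean_space"
  assumes "0 < h" "h \<le> norm v" "h \<le> norm w"
  shows "norm (reflect v x - reflect w x) \<le> (1 + 8 * norm x / h) * norm (v - w)"
proof -
  have s: "reflect z x = x + z - (2 * (x \<bullet> sgn z)) *\<^sub>R sgn z" if "z \<noteq> 0" for z
    using that by (simp add: reflect_def side_def sgn_div_norm dot_square_norm power2_eq_square algebra_simps divide_inverse)
  have nz: "v \<noteq> 0" "w \<noteq> 0" using assms by auto
  have "reflect v x - reflect w x = (v - w) - 2 *\<^sub>R ((x \<bullet> sgn v) *\<^sub>R (sgn v - sgn w) + (x \<bullet> (sgn v - sgn w)) *\<^sub>R sgn w)"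
    unfolding s[OF nz(1)] s[OF nz(2)] by (simp add: algebra_simps inner_diff_right)
  then have "norm (reflect v x - reflect w x) \<le> norm (v - w) + 2 * norm ((x \<bullet> sgn v) *\<^sub>R (sgn v - sgn w) + (x \<bullet> (sgn v - sgn w)) *\<^sub>R sgn w)"
    using norm_triangle_ineq4[of "v - w"] by (metis norm_scaleR abs_numeral)
  also have "norm ((x \<bullet> sgn v) *\<^sub>R (sgn v - sgn w) + (x \<bullet> (sgn v - sgn w)) *\<^sub>R sgn w)
     \<le> \<bar>x \<bullet> sgn v\<bar> * norm (sgn v - sgn w) + \<bar>x \<bullet> (sgn v - sgn w)\<bar> * norm (sgn w)"
    using norm_triangle_ineq[of "(x \<bullet> sgn v) *\<^sub>R (sgn v - sgn w)"] by (metis norm_scaleR)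
  also have "\<dots> \<le> (norm x * 1) * norm (sgn v - sgn w) + (norm x * norm (sgn v - sgn w)) * 1"
    using Cauchy_Schwarz_ineq2[of x "sgn v"] Cauchy_Schwarz_ineq2[of x "sgn v - sgn w"] nz
    by (intro add_mono mult_mono) (auto simp: norm_sgn)
  also have "\<dots> = 2 * norm x * norm (sgn v - sgn w)" by simp
  also have "\<dots> \<le> 2 * norm x * (2 / h * norm (v - w))"
    using norm_sgn_diff_le[OF assms] by (intro mult_left_mono) auto
  finally show ?thesis by (simp add: algebra_simps)
qed

text \<open>The mirror must bisect \<open>x\<close> and \<open>y\<close>. The image \<open>v\<close>
  of 0 is then a multiple of \<open>y - x\<close>, of norm
  \<open>((norm y)^2 - (norm x)^2) / norm (y - x)\<close>, and both bounds follow from the triangle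
  inequality for \<open>norm (y - x)\<close>. They confine \<open>v\<close> to an annulus: away from
  0, where the Lipschitz bound would break down, and of finite measure.\<close>

lemma reflect_onto:
  fixes x y :: "'a::euclidean_space"
  assumes xy: "norm x < norm y"
  obtains v where "reflect v x = y" "norm y - norm x \<le> norm v" "norm v \<le> norm x + norm y"
proof -
  have ne: "norm (y - x) > 0" using xy by auto
  define t where "t = ((norm y)\<^sup>2 - (norm x)\<^sup>2) / (norm (y - x))\<^sup>2"
  define v where "v = t *\<^sub>R (y - x)"
  have sq: "(norm y)\<^sup>2 - (norm x)\<^sup>2 = (norm y - norm x) * (norm x + norm y)"
    by (simp add: power2_eq_square algebra_simps)
  have pos: "(norm y)\<^sup>2 - (norm x)\<^sup>2 > 0"
    unfolding sq using xy norm_ge_zero[of x] by (intro mult_pos_pos) linarith+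
  have t: "t > 0" using pos ne by (simp add: t_def)
  have tn: "t * (norm (y - x))\<^sup>2 = (norm y)\<^sup>2 - (norm x)\<^sup>2" using ne by (simp add: t_def)
  have d2: "(norm (y - x))\<^sup>2 = (norm y)\<^sup>2 + (norm x)\<^sup>2 - 2 * (x \<bullet> y)"
    by (simp add: power2_norm_eq_inner inner_diff_left inner_diff_right inner_commute)
  have vv: "v \<bullet> v = t * ((norm y)\<^sup>2 - (norm x)\<^sup>2)"
    using tn by (simp add: v_def power2_norm_eq_inner)
  have xv: "x \<bullet> v = t * (x \<bullet> y - (norm x)\<^sup>2)"
    by (simp add: v_def inner_diff_right power2_norm_eq_inner)
  have "side v x = 1 - 2 * (x \<bullet> y - (norm x)\<^sup>2) / ((norm y)\<^sup>2 - (norm x)\<^sup>2)"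
    unfolding side_def vv xv using t by simp
  also have "\<dots> = (norm (y - x))\<^sup>2 / ((norm y)\<^sup>2 - (norm x)\<^sup>2)"
    using pos xy by (subst d2) (simp add: divide_simps)
  finally have "side v x * t = 1" using pos ne xy by (simp add: t_def)
  then have 1: "reflect v x = y" by (simp add: reflect_def v_def)
  have nv: "norm v = ((norm y)\<^sup>2 - (norm x)\<^sup>2) / norm (y - x)"
  proof -
    have "norm v = t * norm (y - x)" using t by (simp add: v_def)
    also have "\<dots> = t * (norm (y - x))\<^sup>2 / norm (y - x)" using ne by (simp add: power2_eq_square)
    finally show ?thesis by (simp only: tn)
  qed
  have 2: "norm y - norm x \<le> norm v"
  proof -
    have "(norm y - norm x) * norm (y - x) \<le> (norm y - norm x) * (norm x + norm y)"
      using xy norm_triangle_ineq4[of y x] by (intro mult_left_mono) auto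
    then show ?thesis unfolding nv sq using ne by (simp add: pos_le_divide_eq)
  qed
  have 3: "norm v \<le> norm x + norm y"
  proof -
    have "(norm y - norm x) * (norm x + norm y) \<le> norm (y - x) * (norm x + norm y)"
      using norm_triangle_ineq2[of y x] by (intro mult_right_mono) auto
    then show ?thesis unfolding nv sq using ne by (simp add: pos_divide_le_eq mult.commute)
  qed
  show ?thesis using 1 2 3 that by blast
qed

lemma measure_Diff_same_measure:
  assumes "A \<in> fmeasurable M" "B \<in> fmeasurable M" "measure M A = measure M B"
  shows "measure M (A - B) = measure M (B - A)"
proof -
  have "measure M (A - A \<inter> B) = measure M A - measure M (A \<inter> B)"
    using assms by (intro measurable_measure_Diff) auto
  moreover have "measure M (B - A \<inter> B) = measure M B - measure M (A \<inter> B)"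
    using assms by (intro measurable_measure_Diff) auto
  moreover have "A - A \<inter> B = A - B" "B - A \<inter> B = B - A" by auto
  ultimately show ?thesis using assms(3) by simp
qed

lemma fmeasurable_lborel_bounded:
  assumes "X \<in> sets borel" "X \<subseteq> ball (0::'a::euclidean_space) S"
  shows "X \<in> fmeasurable lborel"
  using assms emeasure_mono[of X "ball 0 S" lborel] emeasure_lborel_ball_finite[of "0::'a" S]
  by (intro fmeasurableI) (auto simp: less_top[symmetric] top_unique)

text \<open>Counted over pairs of mirror images, no pair gets more points of the ball missing from
  the set. A pair with one point in \<open>ball 0 R - A\<close> and the other in
  \<open>A - ball 0 R\<close> has its single missing point filled.\<close>

lemma measure_polarize_deficit:
  fixes A :: "'a::euclidean_space set"
  assumes v: "v \<noteq> 0" and [measurable]: "A \<in> sets borel"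
  shows "measure lborel (ball 0 R - polarize v A)
           + measure lborel {x \<in> ball 0 R - A. reflect v x \<in> A - ball 0 R}
       \<le> measure lborel (ball 0 R - A)"
proof -
  define D where "D = ball (0::'a) R"
  have [measurable]: "D \<in> sets borel" by (simp add: D_def)
  define G where "G = {x \<in> D - A. reflect v x \<in> A - D}"
  have [measurable]: "G \<in> sets borel"
  proof -
    have "Measurable.pred borel (\<lambda>x. x \<in> G)" unfolding G_def by measurable
    then show ?thesis by (simp add: pred_def)
  qed
  have *: "2 * emeasure lborel B = (\<integral>\<^sup>+x. indicator B x + indicator B (reflect v x) \<partial>lborel)"
    if [measurable]: "B \<in> sets borel" for B
    by (subst nn_integral_add) (auto simp: nn_integral_reflect[OF v, of "indicator B"] mult_2)
  \<comment> \<open>The only property of the ball that matters for the pairwise count: if the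
    farther point of a pair lies in it, so does the nearer one.\<close>
  have D: "y \<in> D \<Longrightarrow> norm x \<le> norm y \<Longrightarrow> x \<in> D" for x y by (simp add: D_def)
  have "(indicator (D - polarize v A) x + indicator (D - polarize v A) (reflect v x))
        + (indicator G x + indicator G (reflect v x))
      \<le> (indicator (D - A) x + indicator (D - A) (reflect v x) :: ennreal)" for x
  proof (cases "norm x \<le> norm (reflect v x)")
    case True
    then have "reflect v x \<in> D \<longrightarrow> x \<in> D" using D[of "reflect v x" x] by simp
    then show ?thesis
      unfolding indicator_def G_def mem_Collect_eq Diff_iff in_polarize_near[OF v True] reflect_reflect[OF v]
      by (cases "x \<in> A"; cases "reflect v x \<in> A"; cases "x \<in> D"; cases "reflect v x \<in> D") simp_all
  next
    case False
    then have "x \<in> D \<longrightarrow> reflect v x \<in> D" using D[of x "reflect v x"] by simp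
    then show ?thesis
      unfolding indicator_def G_def mem_Collect_eq Diff_iff in_polarize_far[OF v False] reflect_reflect[OF v]
      by (cases "x \<in> A"; cases "reflect v x \<in> A"; cases "x \<in> D"; cases "reflect v x \<in> D") simp_all
  qed
  then have "(\<integral>\<^sup>+x. (indicator (D - polarize v A) x + indicator (D - polarize v A) (reflect v x))
        + (indicator G x + indicator G (reflect v x)) \<partial>lborel)
      \<le> (\<integral>\<^sup>+x. indicator (D - A) x + indicator (D - A) (reflect v x) \<partial>lborel)"
    by (rule nn_integral_mono)
  then have "2 * (emeasure lborel (D - polarize v A) + emeasure lborel G) \<le> 2 * emeasure lborel (D - A)"
    by (subst (asm) nn_integral_add) (auto simp: distrib_left *)
  then have le: "emeasure lborel (D - polarize v A) + emeasure lborel G \<le> emeasure lborel (D - A)"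
    by (subst (asm) ennreal_mult_le_mult_iff) auto
  have fin: "emeasure lborel X = ennreal (measure lborel X)" if "X \<subseteq> D" "X \<in> sets borel" for X
    using that fmeasurable_lborel_bounded[of X R] by (intro emeasure_eq_measure2) (simp add: D_def)
  have "G \<subseteq> D" by (auto simp: G_def)
  then show ?thesis
    using le unfolding D_def[symmetric] G_def[symmetric]
    by (simp add: fin flip: ennreal_plus)
qed

text \<open>Averaged over all reflections, the set swapped into the ball has positive measure: for fixed
  \<open>x\<close> in the ball, \<open>v \<mapsto> reflect v x\<close> is Lipschitz as long as \<open>v\<close> stays away from \<open>0\<close>,
  so it cannot map a small set of parameters onto the part of \<open>A\<close> far outside the ball.\<close>

lemma polarize_gain:
  assumes "d > 0" "M > 0"
  obtains g where "g > 0"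
    "\<And>A :: 'a::euclidean_space set. A \<in> sets borel \<Longrightarrow> A \<subseteq> ball 0 M \<Longrightarrow>
       measure lborel A = measure lborel (ball (0::'a) R) \<Longrightarrow> d \<le> measure lborel (ball 0 R - A) \<Longrightarrow>
       \<exists>v. v \<noteq> 0 \<and> measure lborel (ball 0 R - polarize v A) \<le> measure lborel (ball 0 R - A) - g"
proof (cases "R \<le> 0")
  case True
  with assms show ?thesis by (intro that[of 1]) (auto simp: ball_empty)
next
  case False
  then have R: "R > 0" by simp
  define N where "N = DIM('a)"
  define V where "V r = unit_ball_vol N * r ^ N" for r :: real
  have mb: "measure lborel (ball (0::'a) r) = V r" if "r \<ge> 0" for r
    using that by (simp add: V_def N_def content_ball)
  \<comment> \<open>By continuity of the volume there is a shell of width \<open>h\<close> around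
    the ball with volume below \<open>d / 2\<close>. At least \<open>d / 2\<close> of
    \<open>A\<close> then lies beyond the shell, at distance at least \<open>h\<close> from the
    ball.\<close>
  have "isCont V R" unfolding V_def by (intro continuous_intros)
  then have "((\<lambda>h. V (R + h)) \<longlongrightarrow> V R) (at 0)"
    by (simp add: isCont_iff)
  then have "\<forall>\<^sub>F h in at_right 0. V (R + h) < V R + d / 2"
    using \<open>d > 0\<close> by (intro order_tendstoD(2)) (auto intro: filterlim_at_split[THEN iffD1, THEN conjunct2])
  moreover have "\<forall>\<^sub>F h::real in at_right 0. h > 0" by (rule eventually_at_right_less)
  ultimately have "\<forall>\<^sub>F h in at_right 0. V (R + h) < V R + d / 2 \<and> h > 0" by eventually_elim simp
  then obtain h where h: "h > 0" "V (R + h) < V R + d / 2"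
    using eventually_happens'[OF trivial_limit_at_right_real] by blast
  \<comment> \<open>The Lipschitz constant of the map from \<open>v\<close> to
    \<open>reflect v x\<close> for \<open>norm x < R\<close> and \<open>norm v > h / 2\<close>. Half
    of \<open>h\<close> is used so that \<open>P\<close> below lies inside an open set on which the
    bound holds.\<close>
  define L where "L = 1 + 8 * R / (h / 2)"
  have L: "L > 0" using R h by (simp add: L_def add_pos_nonneg)
  define C where "C = (2 * L * N) ^ N"
  have C: "C > 0" using L by (simp add: C_def N_def)
  \<comment> \<open>By \<open>reflect_onto\<close>, each point of the ball is carried to each point
    \<open>y\<close> with \<open>R + h \<le> norm y < M\<close> by some parameter in this
    annulus.\<close>
  define P where "P = {v::'a. h \<le> norm v \<and> norm v \<le> R + M}"
  have Pm[measurable]: "P \<in> sets borel"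
  proof -
    have "Measurable.pred borel (\<lambda>x. x \<in> P)" unfolding P_def by measurable
    then show ?thesis by (simp add: pred_def)
  qed
  have Pfin: "emeasure lborel P < \<infinity>"
  proof -
    have "emeasure lborel P \<le> emeasure lborel (cball (0::'a) (R + M))"
      by (intro emeasure_mono) (auto simp: P_def)
    also have "\<dots> < \<infinity>" using R \<open>M > 0\<close> by (simp add: emeasure_cball)
    finally show ?thesis .
  qed
  define p where "p = measure lborel P"
  have ep: "emeasure lborel P = ennreal p"
    unfolding p_def using Pfin by (intro emeasure_eq_ennreal_measure) auto
  have p0: "p \<ge> 0" by (simp add: p_def)
  \<comment> \<open>If no parameter in \<open>P\<close> gained \<open>g\<close>, averaging over
    \<open>P\<close> would give \<open>d * (d / 2) / C \<le> g * p\<close>. The factor 4 in place of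
    2 contradicts this strictly, and \<open>p + 1\<close> keeps the denominator positive when
    \<open>p = 0\<close>.\<close>
  define g where "g = d * d / (4 * C * (p + 1))"
  have g: "g > 0" using \<open>d > 0\<close> C p0 by (simp add: g_def)
  have gp: "g * p < d * (d / 2 / C)"
  proof -
    have "g * p \<le> g * (p + 1)" using g by simp
    also have "\<dots> = d * d / (4 * C)" using C p0 by (simp add: g_def)
    also have "\<dots> < d * (d / 2 / C)" using \<open>d > 0\<close> C by (simp add: field_simps)
    finally show ?thesis .
  qed
  show ?thesis
  proof (rule that[OF g])
    fix A :: "'a set"
    assume A[measurable]: "A \<in> sets borel" and AM: "A \<subseteq> ball 0 M"
      and mA: "measure lborel A = measure lborel (ball (0::'a) R)" and dA: "d \<le> measure lborel (ball 0 R - A)"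
    define D where "D = ball (0::'a) R"
    have [measurable]: "D \<in> sets borel" by (simp add: D_def)
    note fm = fmeasurable_lborel_bounded
    define E where "E = A - ball 0 (R + h)"
    have [measurable]: "E \<in> sets borel" by (simp add: E_def)
    have mAD: "measure lborel (A - D) = measure lborel (D - A)"
      using fm[OF A AM] fm[of D R] mA by (intro measure_Diff_same_measure) (auto simp: D_def)
    have E: "d / 2 \<le> measure lborel E"
    proof -
      have "measure lborel (A - D) \<le> measure lborel (E \<union> (ball 0 (R + h) - D))"
        using fm[OF A AM] fm[of "ball 0 (R + h)" "R + h"]
        by (intro measure_mono_fmeasurable fmeasurable.Un fmeasurable_Diff) (auto simp: E_def)
      also have "\<dots> \<le> measure lborel E + measure lborel (ball 0 (R + h) - D)"
        using fm[OF A AM] fm[of "ball 0 (R + h)" "R + h"]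
        by (intro measure_Un_le) (auto simp: E_def)
      also have "measure lborel (ball 0 (R + h) - D) = V (R + h) - V R"
        using R h fm[of "ball 0 (R + h)" "R + h"] fm[of D R] unfolding D_def
        by (subst measurable_measure_Diff) (auto simp: mb)
      finally show ?thesis using h dA mAD by (simp add: D_def)
    qed
    define G where "G v = {x \<in> D - A. reflect v x \<in> E}" for v
    have Gm[measurable]: "Measurable.pred (borel \<Otimes>\<^sub>M borel) (\<lambda>(v, x). x \<in> G v)"
      unfolding G_def by measurable
    have Gv: "G v \<in> sets borel" for v
    proof -
      have "Measurable.pred borel (\<lambda>x. x \<in> G v)" unfolding G_def by measurable
      then show ?thesis by (simp add: pred_def)
    qed
    \<comment> \<open>Every point of \<open>E\<close> is the image of \<open>x\<close> for some
      parameter in \<open>P\<close>, so \<open>E\<close> is covered by a Lipschitz image of the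
      parameters that send \<open>x\<close> into \<open>E\<close>; these cannot form too small a
      set.\<close>
    have key: "emeasure lborel E \<le> C * emeasure lborel {v \<in> P. reflect v x \<in> E}" if x: "x \<in> D - A" for x
      unfolding C_def N_def
    proof (rule emeasure_lipschitz_image_le)
      show "open {v::'a. h / 2 < norm v}" by (intro open_Collect_less continuous_intros)
      show "{v \<in> P. reflect v x \<in> E} \<subseteq> {v. h / 2 < norm v}" using h by (auto simp: P_def)
      show "{v \<in> P. reflect v x \<in> E} \<in> sets borel"
      proof -
        have "Measurable.pred borel (\<lambda>v. v \<in> {v \<in> P. reflect v x \<in> E})" unfolding mem_Collect_eq by measurable
        then show ?thesis by (simp add: pred_def)
      qed
      show "bounded {v \<in> P. reflect v x \<in> E}"
        by (rule bounded_subset[OF bounded_cball[of 0 "R + M"]]) (auto simp: P_def)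
      show "norm (reflect v x - reflect w x) \<le> L * norm (v - w)"
        if "v \<in> {v. h / 2 < norm v}" "w \<in> {v. h / 2 < norm v}" for v w
      proof -
        have "norm (reflect v x - reflect w x) \<le> (1 + 8 * norm x / (h / 2)) * norm (v - w)"
          using that h by (intro reflect_lipschitz) auto
        also have "\<dots> \<le> L * norm (v - w)"
          unfolding L_def using x h by (intro mult_right_mono add_left_mono divide_right_mono) (auto simp: D_def)
        finally show ?thesis .
      qed
      show "E \<subseteq> (\<lambda>v. reflect v x) ` {v \<in> P. reflect v x \<in> E}"
      proof
        fix y assume y: "y \<in> E"
        then have ny: "R + h \<le> norm y" "norm y < M" using AM by (auto simp: E_def)
        have nx: "norm x < R" using x by (simp add: D_def)
        have "norm x < norm y" using nx ny h by simp
        then obtain v where "reflect v x = y" "norm y - norm x \<le> norm v" "norm v \<le> norm x + norm y"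
          by (rule reflect_onto)
        with y nx ny show "y \<in> (\<lambda>v. reflect v x) ` {v \<in> P. reflect v x \<in> E}"
          by (intro image_eqI[of _ _ v]) (auto simp: P_def)
      qed
    qed (use L in auto)
    \<comment> \<open>Averaging: by Fubini, the integral over \<open>P\<close> of the measure of
      \<open>G v\<close> is the integral over \<open>x\<close> in \<open>D - A\<close> of the
      measure of the parameters that send \<open>x\<close> into \<open>E\<close>, and
      \<open>key\<close> bounds the latter below by the product of the measures of
      \<open>D - A\<close> and \<open>E\<close> over \<open>C\<close>.\<close>
    have "\<exists>v\<in>P. ennreal g \<le> emeasure lborel (G v)"
    proof (rule ccontr)
      assume "\<not> ?thesis"
      then have less: "emeasure lborel (G v) \<le> g" if "v \<in> P" for v using that by (auto simp: not_le less_imp_le)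
      have "ennreal (d * (d / 2 / C)) = ennreal d * ennreal (d / 2) / ennreal C"
        using \<open>d > 0\<close> C by (simp add: divide_ennreal flip: ennreal_mult)
      also have "\<dots> \<le> emeasure lborel (D - A) * emeasure lborel E / ennreal C"
      proof (intro divide_right_mono_ennreal mult_mono)
        show "ennreal d \<le> emeasure lborel (D - A)"
          using dA fm[of "D - A" R] by (simp add: emeasure_eq_measure2 D_def)
        show "ennreal (d / 2) \<le> emeasure lborel E"
          using E fm[of E M] AM by (subst emeasure_eq_measure2) (auto simp: E_def)
      qed auto
      also have "\<dots> = (\<integral>\<^sup>+x. indicator (D - A) x * (emeasure lborel E / ennreal C) \<partial>lborel)"
        by (subst nn_integral_multc) (auto simp: ennreal_times_divide)
      also have "\<dots> \<le> (\<integral>\<^sup>+x. indicator (D - A) x * emeasure lborel {v \<in> P. reflect v x \<in> E} \<partial>lborel)"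
      proof (intro nn_integral_mono)
        fix x
        have "emeasure lborel E / C \<le> emeasure lborel {v \<in> P. reflect v x \<in> E}" if "x \<in> D - A"
          using key[OF that] C by (simp add: divide_le_posI_ennreal mult.commute)
        then show "indicator (D - A) x * (emeasure lborel E / C)
           \<le> indicator (D - A) x * emeasure lborel {v \<in> P. reflect v x \<in> E}"
          by (auto simp: indicator_def)
      qed
      also have "\<dots> = (\<integral>\<^sup>+x. (\<integral>\<^sup>+v. indicator P v * indicator (G v) x \<partial>lborel) \<partial>lborel)"
      proof (intro nn_integral_cong)
        fix x
        have m: "{v \<in> P. reflect v x \<in> E} \<in> sets borel"
        proof -
          have "Measurable.pred borel (\<lambda>v. v \<in> {v \<in> P. reflect v x \<in> E})" unfolding mem_Collect_eq by measurable
          then show ?thesis by (simp add: pred_def)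
        qed
        have "indicator (D - A) x * emeasure lborel {v \<in> P. reflect v x \<in> E}
           = indicator (D - A) x * (\<integral>\<^sup>+v. indicator {v \<in> P. reflect v x \<in> E} v \<partial>lborel)"
          using m by simp
        also have "\<dots> = (\<integral>\<^sup>+v. indicator (D - A) x * indicator {v \<in> P. reflect v x \<in> E} v \<partial>lborel)"
          using m by (intro nn_integral_cmult[symmetric]) simp
        also have "\<dots> = (\<integral>\<^sup>+v. indicator P v * indicator (G v) x \<partial>lborel)"
          by (intro nn_integral_cong) (auto simp: indicator_def G_def)
        finally show "indicator (D - A) x * emeasure lborel {v \<in> P. reflect v x \<in> E} = \<dots>" .
      qed
      also have "\<dots> = (\<integral>\<^sup>+v. (\<integral>\<^sup>+x. indicator P v * indicator (G v) x \<partial>lborel) \<partial>lborel)"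
        by (rule lborel_pair.Fubini') (simp add: indicator_def)
      also have "\<dots> = (\<integral>\<^sup>+v. indicator P v * emeasure lborel (G v) \<partial>lborel)"
        using Gv by (intro nn_integral_cong) (simp add: nn_integral_cmult)
      also have "\<dots> \<le> (\<integral>\<^sup>+v. ennreal g * indicator P v \<partial>lborel)"
        using less by (intro nn_integral_mono) (auto simp: indicator_def)
      also have "\<dots> = g * emeasure lborel P"
        by (simp add: nn_integral_cmult)
      also have "\<dots> = ennreal (g * p)"
        using g p0 by (simp add: ep ennreal_mult)
      finally show False using gp g p0 by simp
    qed
    then obtain v where v: "v \<in> P" "ennreal g \<le> emeasure lborel (G v)" by blast
    have v0: "v \<noteq> 0" using v(1) h by (auto simp: P_def)
    have Gfm: "G v \<in> fmeasurable lborel"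
      using Gv by (intro fm[of _ R]) (auto simp: G_def D_def)
    have "g \<le> measure lborel (G v)"
      using v(2) Gfm g by (simp add: emeasure_eq_measure2)
    also have "\<dots> \<le> measure lborel {x \<in> D - A. reflect v x \<in> A - D}"
    proof (rule measure_mono_fmeasurable)
      show "G v \<subseteq> {x \<in> D - A. reflect v x \<in> A - D}" using h by (auto simp: G_def E_def D_def)
      have "Measurable.pred borel (\<lambda>x. x \<in> {x \<in> D - A. reflect v x \<in> A - D})" unfolding mem_Collect_eq by measurable
      then show "{x \<in> D - A. reflect v x \<in> A - D} \<in> fmeasurable lborel"
        by (intro fm[of _ R]) (auto simp: pred_def D_def)
    qed (use Gv in simp)
    finally show "\<exists>v. v \<noteq> 0 \<and> measure lborel (ball 0 R - polarize v A) \<le> measure lborel (ball 0 R - A) - g"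
      using v0 measure_polarize_deficit[OF v0 A, of R] by (intro exI[of _ v]) (simp add: D_def)
  qed
qed

section \<open>Riesz' inequality\<close>

lemma riesz_commute:
  assumes [measurable]: "k \<in> borel_measurable borel" "f \<in> borel_measurable borel" "g \<in> borel_measurable borel"
  shows "riesz k f g = riesz k g f"
proof -
  have "riesz k f g = (\<integral>\<^sup>+y. \<integral>\<^sup>+x. ennreal (f x * g y * k (norm (x - y))) \<partial>lborel \<partial>lborel)"
    unfolding riesz_def by (rule lborel_pair.Fubini') measurable
  then show ?thesis
    unfolding riesz_def by (simp add: norm_minus_commute mult_ac)
qed

text \<open>Used to replace the level sets of a symmetrized function, which are balls without their
  centre, by full balls.\<close>

lemma riesz_cong_AE:
  assumes "AE x in lborel. f x = f' x" "AE x in lborel. g x = g' x"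
  shows "riesz k f g = riesz k f' g'"
  unfolding riesz_def
proof (rule nn_integral_cong_AE)
  show "AE x in lborel. (\<integral>\<^sup>+y. ennreal (f x * g y * k (norm (x - y))) \<partial>lborel)
      = (\<integral>\<^sup>+y. ennreal (f' x * g' y * k (norm (x - y))) \<partial>lborel)"
    using assms(1)
  proof eventually_elim
    case (elim x)
    show ?case
    proof (rule nn_integral_cong_AE)
      show "AE y in lborel. ennreal (f x * g y * k (norm (x - y))) = ennreal (f' x * g' y * k (norm (x - y)))"
        using assms(2) by eventually_elim (simp add: elim)
    qed
  qed
qed

text \<open>The deficits of both sets are added. As long as the infimum \<open>Inf Def\<close> is
  positive, one of the two is at least half of it, and \<open>polarize_gain\<close> lowers that one
  by a fixed amount while the other does not grow. Applied to a pair close enough to the infimum,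
  this falls below the infimum.\<close>

lemma riesz_le_balls:
  fixes A B :: "'a::euclidean_space set"
  assumes k: "antimono k" "\<And>x. 0 \<le> k x" "\<And>x. k x \<le> K"
    and [measurable]: "k \<in> borel_measurable borel"
    and A[measurable]: "A \<in> sets borel" "A \<subseteq> ball 0 M" "measure lborel A = measure lborel (ball (0::'a) R)"
    and B[measurable]: "B \<in> sets borel" "B \<subseteq> ball 0 M" "measure lborel B = measure lborel (ball (0::'a) S)"
  shows "riesz k (indicator A) (indicator B) \<le> riesz k (indicator (ball (0::'a) R)) (indicator (ball 0 S))"
proof -
  define D E where "D = ball (0::'a) R" and "E = ball (0::'a) S"
  have [measurable]: "D \<in> sets borel" "E \<in> sets borel" by (simp_all add: D_def E_def)
  have fmDE: "D \<in> fmeasurable lborel" "E \<in> fmeasurable lborel"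
    by (auto simp: D_def E_def intro: fmeasurable_lborel_bounded)
  \<comment> \<open>A positive radius, as \<open>polarize_gain\<close> requires.\<close>
  define M' where "M' = max M 1"
  have M': "M' > 0" "ball (0::'a) M \<subseteq> ball 0 M'" by (auto simp: M'_def)
  define P where "P X Y \<longleftrightarrow> X \<in> sets borel \<and> X \<subseteq> ball 0 M' \<and> measure lborel X = measure lborel D \<and>
      Y \<in> sets borel \<and> Y \<subseteq> ball 0 M' \<and> measure lborel Y = measure lborel E \<and>
      riesz k (indicator A) (indicator B) \<le> riesz k (indicator X) (indicator Y)" for X Y :: "'a set"
  define def where "def X Y = measure lborel (D - X) + measure lborel (E - Y)" for X Y :: "'a set"
  define Def where "Def = {def X Y |X Y. P X Y}"
  have "P A B" using A B M' by (auto simp: P_def D_def E_def)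
  then have ne: "Def \<noteq> {}" by (auto simp: Def_def)
  have bdd: "bdd_below Def" by (rule bdd_belowI[of _ 0]) (auto simp: Def_def def_def)
  have polP: "P (polarize v X) (polarize v Y)" if "P X Y" "v \<noteq> 0" for X Y v
    using that riesz_polarize[of v k X Y] k
    by (auto simp: P_def polarize_subset_ball measure_def emeasure_polarize intro: order_trans)
  have polle: "measure lborel (ball 0 T - polarize v X) \<le> measure lborel (ball 0 T - X)"
    if "X \<in> sets borel" "v \<noteq> 0" for X :: "'a set" and v T
    using measure_polarize_deficit[OF that(2,1), of T] measure_nonneg[of lborel] by (smt (verit))
  have "Inf Def \<le> 0"
  proof (rule ccontr)
    assume "\<not> Inf Def \<le> 0"
    then have d: "Inf Def / 2 > 0" by simp
    obtain g1 where g1: "g1 > 0" "\<And>X :: 'a set. X \<in> sets borel \<Longrightarrow> X \<subseteq> ball 0 M' \<Longrightarrow>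
       measure lborel X = measure lborel D \<Longrightarrow> Inf Def / 2 \<le> measure lborel (D - X) \<Longrightarrow>
       \<exists>v. v \<noteq> 0 \<and> measure lborel (D - polarize v X) \<le> measure lborel (D - X) - g1"
      unfolding D_def using polarize_gain[OF d M'(1), where R = R and 'a = 'a] by metis
    obtain g2 where g2: "g2 > 0" "\<And>X :: 'a set. X \<in> sets borel \<Longrightarrow> X \<subseteq> ball 0 M' \<Longrightarrow>
       measure lborel X = measure lborel E \<Longrightarrow> Inf Def / 2 \<le> measure lborel (E - X) \<Longrightarrow>
       \<exists>v. v \<noteq> 0 \<and> measure lborel (E - polarize v X) \<le> measure lborel (E - X) - g2"
      unfolding E_def using polarize_gain[OF d M'(1), where R = S and 'a = 'a] by metis
    have "Inf Def < Inf Def + min g1 g2" using g1 g2 by simp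
    then obtain z where "z \<in> Def" "z < Inf Def + min g1 g2"
      using cInf_lessD[OF ne] by blast
    then obtain X Y where XY: "P X Y" "def X Y < Inf Def + min g1 g2"
      unfolding Def_def by blast
    have "def X Y \<in> Def" using XY by (auto simp: Def_def)
    then have "Inf Def \<le> def X Y" using bdd by (rule cInf_lower)
    then have "Inf Def / 2 \<le> measure lborel (D - X) \<or> Inf Def / 2 \<le> measure lborel (E - Y)"
      by (auto simp: def_def)
    then have "\<exists>v. v \<noteq> 0 \<and> def (polarize v X) (polarize v Y) \<le> def X Y - min g1 g2"
    proof
      assume "Inf Def / 2 \<le> measure lborel (D - X)"
      then obtain v where v: "v \<noteq> 0" "measure lborel (D - polarize v X) \<le> measure lborel (D - X) - g1"
        using g1(2)[of X] XY(1) by (auto simp: P_def)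
      then show ?thesis
        using polle[of Y v S] XY(1) by (intro exI[of _ v]) (auto simp: def_def P_def E_def)
    next
      assume "Inf Def / 2 \<le> measure lborel (E - Y)"
      then obtain v where v: "v \<noteq> 0" "measure lborel (E - polarize v Y) \<le> measure lborel (E - Y) - g2"
        using g2(2)[of Y] XY(1) by (auto simp: P_def)
      then show ?thesis
        using polle[of X v R] XY(1) by (intro exI[of _ v]) (auto simp: def_def P_def D_def)
    qed
    then obtain v where v: "v \<noteq> 0" "def (polarize v X) (polarize v Y) \<le> def X Y - min g1 g2" by blast
    have "def (polarize v X) (polarize v Y) \<in> Def" using polP[OF XY(1) v(1)] by (auto simp: Def_def)
    then have "Inf Def \<le> def (polarize v X) (polarize v Y)" using bdd by (rule cInf_lower)
    with v XY(2) show False by simp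
  qed
  \<comment> \<open>Replacing \<open>X\<close> by \<open>D\<close> and then \<open>Y\<close> by
    \<open>E\<close> costs at most \<open>e / c\<close> in each measure, hence at most
    \<open>K * (measure lborel D + measure lborel E) * (e / c)\<close> in the double integral. The
    summand 1 makes \<open>c\<close> positive.\<close>
  define c where "c = K * (measure lborel D + measure lborel E) + 1"
  have K0: "K \<ge> 0" using k(2,3)[of 0] by linarith
  then have c: "c > 0" unfolding c_def by (intro add_nonneg_pos mult_nonneg_nonneg) auto
  have "riesz k (indicator A) (indicator B) \<le> riesz k (indicator D) (indicator E)"
  proof (rule ennreal_le_epsilon)
    fix e :: real assume e: "e > 0"
    have "Inf Def < e / c" using \<open>Inf Def \<le> 0\<close> e c by (meson divide_pos_pos le_less_trans)
    then obtain z where "z \<in> Def" "z < e / c"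
      using cInf_lessD[OF ne] by blast
    then obtain X Y where XY: "P X Y" "def X Y < e / c"
      unfolding Def_def by blast
    have X[measurable]: "X \<in> sets borel" and Y[measurable]: "Y \<in> sets borel"
      using XY(1) by (simp_all add: P_def)
    have fm: "X \<in> fmeasurable lborel" "Y \<in> fmeasurable lborel"
      using XY(1) by (auto simp: P_def intro: fmeasurable_lborel_bounded)
    have fm': "X - D \<in> fmeasurable lborel" "Y - E \<in> fmeasurable lborel"
      using fm by (auto intro: fmeasurable_Diff)
    have em: "emeasure lborel (X - D) \<le> ennreal (e / c)" "emeasure lborel (Y - E) \<le> ennreal (e / c)"
    proof -
      have "measure lborel (X - D) = measure lborel (D - X)" "measure lborel (Y - E) = measure lborel (E - Y)"
        using fm fmDE XY(1) by (auto intro!: measure_Diff_same_measure simp: P_def)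
      moreover have "measure lborel (D - X) \<ge> 0" "measure lborel (E - Y) \<ge> 0" by simp_all
      ultimately have "measure lborel (X - D) \<le> e / c" "measure lborel (Y - E) \<le> e / c"
        using XY(2) unfolding def_def by linarith+
      then show "emeasure lborel (X - D) \<le> ennreal (e / c)" "emeasure lborel (Y - E) \<le> ennreal (e / c)"
        using fm' by (simp_all add: emeasure_eq_measure2 ennreal_leI)
    qed
    have prod: "(\<integral>\<^sup>+x. \<integral>\<^sup>+y. ennreal K * (indicator Z x * indicator W y) \<partial>lborel \<partial>lborel)
        = ennreal K * (emeasure lborel Z * emeasure lborel W)"
      if "Z \<in> sets borel" "W \<in> sets borel" for Z W :: "'a set"
      using that by (simp add: nn_integral_cmult nn_integral_multc)
    have "riesz k (indicator A) (indicator B) \<le> riesz k (indicator X) (indicator Y)"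
      using XY(1) by (simp add: P_def)
    \<comment> \<open>A pair in \<open>X \<times> Y\<close> has \<open>x\<close> outside
      \<open>D\<close>, or \<open>x\<close> in \<open>D\<close> and \<open>y\<close> outside
      \<open>E\<close>, or lies in \<open>D \<times> E\<close>; in the first two cases the kernel is
      bounded by \<open>K\<close>.\<close>
    also have "\<dots> \<le> (\<integral>\<^sup>+x. \<integral>\<^sup>+y. ennreal (indicator D x * indicator E y * k (norm (x - y)))
        + (ennreal K * (indicator (X - D) x * indicator Y y)
        + ennreal K * (indicator D x * indicator (Y - E) y)) \<partial>lborel \<partial>lborel)"
      unfolding riesz_def using k(2,3)
      by (intro nn_integral_mono) (auto simp: indicator_def intro!: ennreal_leI intro: order_trans[OF _ add_increasing])
    also have "\<dots> = riesz k (indicator D) (indicator E)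
       + (ennreal K * (emeasure lborel (X - D) * emeasure lborel Y)
       + ennreal K * (emeasure lborel D * emeasure lborel (Y - E)))"
      unfolding riesz_def by (simp add: nn_integral_add prod)
    also have "\<dots> \<le> riesz k (indicator D) (indicator E) +
        (ennreal K * (ennreal (e / c) * emeasure lborel Y)
       + ennreal K * (emeasure lborel D * ennreal (e / c)))"
      by (intro add_mono mult_mono em order_refl) auto
    also have "(ennreal K * (ennreal (e / c) * emeasure lborel Y)
       + ennreal K * (emeasure lborel D * ennreal (e / c))) = ennreal (K * (e / c * measure lborel E) + K * (measure lborel D * (e / c)))"
      using fm fmDE K0 e c XY(1) by (simp add: emeasure_eq_measure2 P_def flip: ennreal_mult ennreal_plus)
    also have "K * (e / c * measure lborel E) + K * (measure lborel D * (e / c)) = (c - 1) * (e / c)"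
      by (simp add: c_def algebra_simps add_divide_distrib)
    also have "\<dots> \<le> e" using e c by (simp add: field_simps)
    finally show "riesz k (indicator A) (indicator B) \<le> riesz k (indicator D) (indicator E) + ennreal e"
      using e by (simp add: add_left_mono ennreal_leI)
  qed
  then show ?thesis by (simp add: D_def E_def)
qed

section \<open>Layer-cake formulas\<close>

lemma ennreal_eq_layers:
  assumes "0 \<le> (a::real)"
  shows "ennreal a = (\<integral>\<^sup>+s\<in>{0..}. indicator {..<a} s \<partial>lborel)"
proof -
  have "(\<integral>\<^sup>+s\<in>{0..}. indicator {..<a} s \<partial>lborel) = (\<integral>\<^sup>+s. indicator {0..<a} s \<partial>lborel)"
    by (intro nn_integral_cong) (auto simp: indicator_def)
  then show ?thesis using assms by simp
qed

lemma nn_integral_layers: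
  fixes f :: "'a::euclidean_space \<Rightarrow> real"
  assumes [measurable]: "f \<in> borel_measurable borel" and f: "\<And>x. 0 \<le> f x"
  shows "(\<integral>\<^sup>+x. ennreal (f x) \<partial>lborel) = (\<integral>\<^sup>+s\<in>{0..}. emeasure lborel {x. s < f x} \<partial>lborel)"
proof -
  have "(\<integral>\<^sup>+x. ennreal (f x) \<partial>lborel)
      = (\<integral>\<^sup>+x. (\<integral>\<^sup>+s. indicator {..<f x} s * indicator {0..} s \<partial>lborel) \<partial>lborel)"
    using f by (intro nn_integral_cong ennreal_eq_layers)
  also have "\<dots> = (\<integral>\<^sup>+x. (\<integral>\<^sup>+s. indicator {x. s < f x} x * indicator {0..} s \<partial>lborel) \<partial>lborel)"
    by (simp add: indicator_def)
  also have "\<dots> = (\<integral>\<^sup>+s. (\<integral>\<^sup>+x. indicator {x. s < f x} x * indicator {0..} s \<partial>lborel) \<partial>lborel)"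
    by (rule lborel_pair.Fubini'[symmetric]) (simp add: indicator_def)
  also have "\<dots> = (\<integral>\<^sup>+s\<in>{0..}. emeasure lborel {x. s < f x} \<partial>lborel)"
    by (intro nn_integral_cong) (simp add: nn_integral_multc)
  finally show ?thesis .
qed

lemma riesz_layers:
  fixes f g :: "'a::euclidean_space \<Rightarrow> real"
  assumes [measurable]: "f \<in> borel_measurable borel" "g \<in> borel_measurable borel" "k \<in> borel_measurable borel"
    and f: "\<And>x. 0 \<le> f x"
  shows "riesz k f g = (\<integral>\<^sup>+s\<in>{0..}. riesz k (indicator {x. s < f x}) g \<partial>lborel)"
proof -
  define h where "h s x y = ennreal (indicator {x. s < f x} x * g y * k (norm (x - y))) * indicator {0..} s"
    for s :: real and x y :: 'a
  have hm[measurable]: "(\<lambda>(s, x, y). h s x y) \<in> borel_measurable (borel \<Otimes>\<^sub>M borel \<Otimes>\<^sub>M borel)"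
    unfolding h_def indicator_def by measurable
  have "ennreal (f x * g y * k (norm (x - y))) = (\<integral>\<^sup>+s. h s x y \<partial>lborel)" for x y
  proof -
    have "ennreal (f x * g y * k (norm (x - y))) = ennreal (f x) * ennreal (g y * k (norm (x - y)))"
      using f by (simp add: ennreal_mult' mult.assoc)
    also have "\<dots> = (\<integral>\<^sup>+s. indicator {..<f x} s * indicator {0..} s * ennreal (g y * k (norm (x - y))) \<partial>lborel)"
      using f by (simp add: nn_integral_multc ennreal_eq_layers[of "f x"])
    also have "\<dots> = (\<integral>\<^sup>+s. h s x y \<partial>lborel)"
      by (intro nn_integral_cong) (auto simp: h_def indicator_def)
    finally show ?thesis .
  qed
  then have "riesz k f g = (\<integral>\<^sup>+x. \<integral>\<^sup>+y. (\<integral>\<^sup>+s. h s x y \<partial>lborel) \<partial>lborel \<partial>lborel)"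
    by (simp add: riesz_def)
  also have "\<dots> = (\<integral>\<^sup>+x. (\<integral>\<^sup>+s. (\<integral>\<^sup>+y. h s x y \<partial>lborel) \<partial>lborel) \<partial>lborel)"
  proof (rule nn_integral_cong)
    fix x :: 'a
    have "(\<lambda>(s, y). h s x y) \<in> borel_measurable (lborel \<Otimes>\<^sub>M lborel)"
      unfolding h_def indicator_def by measurable
    then show "(\<integral>\<^sup>+y. (\<integral>\<^sup>+s. h s x y \<partial>lborel) \<partial>lborel) = (\<integral>\<^sup>+s. (\<integral>\<^sup>+y. h s x y \<partial>lborel) \<partial>lborel)"
      by (rule lborel_pair.Fubini')
  qed
  also have "\<dots> = (\<integral>\<^sup>+s. (\<integral>\<^sup>+x. (\<integral>\<^sup>+y. h s x y \<partial>lborel) \<partial>lborel) \<partial>lborel)"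
  proof (rule lborel_pair.Fubini'[symmetric])
    show "(\<lambda>(x, s). \<integral>\<^sup>+y. h s x y \<partial>lborel) \<in> borel_measurable (lborel \<Otimes>\<^sub>M lborel)"
      unfolding h_def indicator_def by measurable
  qed
  also have "\<dots> = (\<integral>\<^sup>+s\<in>{0..}. riesz k (indicator {x. s < f x}) g \<partial>lborel)"
    unfolding riesz_def h_def by (intro nn_integral_cong) (auto simp: indicator_def)
  finally show ?thesis .
qed

section \<open>Symmetric decreasing rearrangement\<close>

text \<open>The value at the origin is a convention: the supremum may be infinite there.\<close>

definition symmetrize :: "('a::euclidean_space \<Rightarrow> real) \<Rightarrow> 'a \<Rightarrow> real" where
  "symmetrize u x = (if x = 0 then 0 else
     Sup (insert 0 {t. 0 \<le> t \<and> measure lborel (ball (0::'a) (norm x)) < measure lborel {y. t < u y}}))"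

text \<open>Bounded support makes all level sets at heights \<open>t \<ge> 0\<close> of finite
  measure, although \<open>u\<close> itself may be unbounded.\<close>

locale symmetrizable =
  fixes u :: "'a::euclidean_space \<Rightarrow> real" and M :: real
  assumes meas [measurable]: "u \<in> borel_measurable borel"
    and nonneg: "\<And>x. 0 \<le> u x"
    and outside: "\<And>x. x \<notin> ball 0 M \<Longrightarrow> u x = 0"
begin

abbreviation dist_fun :: "real \<Rightarrow> real" where
  "dist_fun t \<equiv> measure lborel {y. t < u y}"

lemma level_subset: "0 \<le> t \<Longrightarrow> {y. t < u y} \<subseteq> ball 0 M"
proof safe
  fix y assume "0 \<le> t" "t < u y"
  then show "y \<in> ball 0 M" using outside[of y] by (cases "y \<in> ball 0 M") auto
qed

lemma level_sets: "{y. t < u y} \<in> sets borel"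
proof -
  have "Measurable.pred borel (\<lambda>y. t < u y)" by measurable
  then show ?thesis by (simp add: pred_def)
qed

lemma level_fmeasurable: "0 \<le> t \<Longrightarrow> {y. t < u y} \<in> fmeasurable lborel"
  using level_subset level_sets by (intro fmeasurable_lborel_bounded)

lemma dist_fun_antimono: "0 \<le> s \<Longrightarrow> s \<le> t \<Longrightarrow> dist_fun t \<le> dist_fun s"
  using level_fmeasurable[of s] level_sets[of t] by (intro measure_mono_fmeasurable) auto

text \<open>For unbounded \<open>u\<close>, this is what keeps the supremum in
  \<open>symmetrize\<close> finite away from the origin.\<close>

lemma dist_fun_tendsto_0: "(\<lambda>n. dist_fun (real n)) \<longlonglongrightarrow> 0"
proof -
  have "(\<lambda>n. dist_fun (real n)) \<longlonglongrightarrow> measure lborel (\<Inter>n. {y. real n < u y})"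
  proof (rule Lim_measure_decseq)
    show "range (\<lambda>n. {y. real n < u y}) \<subseteq> sets lborel" using level_sets by auto
    show "decseq (\<lambda>n. {y. real n < u y})" by (auto simp: decseq_def)
    show "emeasure lborel {y. real n < u y} \<noteq> \<infinity>" for n
      using level_fmeasurable[of "real n"] by (auto simp: fmeasurable_def)
  qed
  moreover have "(\<Inter>n. {y. real n < u y}) = {}"
  proof safe
    fix y assume y: "y \<in> (\<Inter>n. {y. real n < u y})"
    obtain n :: nat where "u y < real n" using reals_Archimedean2 by blast
    moreover have "real n < u y" using y by blast
    ultimately show "y \<in> {}" by simp
  qed
  ultimately show ?thesis by simp
qed

text \<open>The supremum over heights is undone by the right-continuity of the distribution
  function; afterwards level sets, measurability and support of \<open>symmetrize u\<close> are all
  obtained from this equivalence.\<close>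

lemma symmetrize_gt_iff:
  assumes x: "x \<noteq> 0" and s: "0 \<le> s"
  shows "s < symmetrize u x \<longleftrightarrow> measure lborel (ball (0::'a) (norm x)) < dist_fun s"
    and "0 \<le> symmetrize u x"
proof -
  define m where "m = measure lborel (ball (0::'a) (norm x))"
  define T where "T = insert 0 {t. 0 \<le> t \<and> m < dist_fun t}"
  have S: "symmetrize u x = Sup T" using x by (simp add: symmetrize_def T_def m_def)
  \<comment> \<open>Away from the origin the ball of radius \<open>norm x\<close> has positive
    measure, so heights at which the level sets are smaller bound \<open>T\<close>.\<close>
  have "m > 0" using x by (simp add: m_def)
  then have "\<forall>\<^sub>F n in sequentially. dist_fun (real n) < m"
    using dist_fun_tendsto_0 by (rule order_tendstoD(2)[rotated])
  then obtain n where n: "dist_fun (real n) < m"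
    by (auto simp: eventually_sequentially)
  have bdd: "bdd_above T"
  proof (rule bdd_aboveI)
    fix t assume t: "t \<in> T"
    show "t \<le> real n"
    proof (rule ccontr)
      assume "\<not> t \<le> real n"
      then have "dist_fun t \<le> dist_fun (real n)" "t \<noteq> 0" by (auto intro: dist_fun_antimono)
      then show False using n t by (auto simp: T_def)
    qed
  qed
  show "0 \<le> symmetrize u x" unfolding S by (rule cSup_upper[OF _ bdd]) (simp add: T_def)
  show "s < symmetrize u x \<longleftrightarrow> measure lborel (ball (0::'a) (norm x)) < dist_fun s"
    unfolding S m_def[symmetric]
  proof
    assume "s < Sup T"
    then obtain t where t: "t \<in> T" "s < t"
      using less_cSupE[of s T] by (auto simp: T_def)
    then have "m < dist_fun t" using s by (auto simp: T_def)
    also have "\<dots> \<le> dist_fun s" using s t by (intro dist_fun_antimono) auto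
    finally show "m < dist_fun s" .
  next
    assume less: "m < dist_fun s"
    \<comment> \<open>Right-continuity at \<open>s\<close>: the strict level set is the increasing
      union of those at \<open>s + 1 / Suc n\<close>. Hence some height strictly above
      \<open>s\<close> also belongs to \<open>T\<close>.\<close>
    have "(\<lambda>n. dist_fun (s + 1 / Suc n)) \<longlonglongrightarrow> measure lborel (\<Union>n. {y. s + 1 / Suc n < u y})"
    proof (rule Lim_measure_incseq)
      show "range (\<lambda>n. {y. s + 1 / Suc n < u y}) \<subseteq> sets lborel" using level_sets by auto
      show "incseq (\<lambda>n. {y. s + 1 / Suc n < u y})"
      proof (rule monoI, safe)
        fix i j :: nat and y assume "i \<le> j" "s + 1 / real (Suc i) < u y"
        moreover have "1 / real (Suc j) \<le> 1 / real (Suc i)" using \<open>i \<le> j\<close> by (simp add: frac_le)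
        ultimately show "s + 1 / real (Suc j) < u y" by linarith
      qed
      have "emeasure lborel (\<Union>n. {y. s + 1 / Suc n < u y}) \<le> emeasure lborel {y. s < u y}"
      proof (rule emeasure_mono)
        show "(\<Union>n. {y. s + 1 / real (Suc n) < u y}) \<subseteq> {y. s < u y}"
        proof safe
          fix n y assume "s + 1 / real (Suc n) < u y"
          moreover have "1 / real (Suc n) > 0" by simp
          ultimately show "s < u y" by linarith
        qed
      qed (simp add: level_sets)
      then show "emeasure lborel (\<Union>n. {y. s + 1 / Suc n < u y}) \<noteq> \<infinity>"
        using level_fmeasurable[OF s] by (auto simp: fmeasurable_def top_unique)
    qed
    moreover have "(\<Union>n. {y. s + 1 / Suc n < u y}) = {y. s < u y}"
    proof safe
      fix n y assume "s + 1 / real (Suc n) < u y"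
      moreover have "1 / real (Suc n) > 0" by simp
      ultimately show "s < u y" by linarith
    next
      fix y assume "s < u y"
      then obtain n where "inverse (real (Suc n)) < u y - s"
        using reals_Archimedean[of "u y - s"] by auto
      then show "y \<in> (\<Union>n. {y. s + 1 / Suc n < u y})"
        by (intro UN_I[of n]) (auto simp: inverse_eq_divide)
    qed
    ultimately have "(\<lambda>n. dist_fun (s + 1 / Suc n)) \<longlonglongrightarrow> dist_fun s" by simp
    then have "\<forall>\<^sub>F n in sequentially. m < dist_fun (s + 1 / Suc n)"
      using less by (rule order_tendstoD(1))
    then obtain n where "m < dist_fun (s + 1 / Suc n)"
      by (auto simp: eventually_sequentially)
    then have "s + 1 / Suc n \<le> Sup T"
      using s by (intro cSup_upper[OF _ bdd]) (simp add: T_def)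
    moreover have "1 / real (Suc n) > 0" by simp
    ultimately show "s < Sup T" by linarith
  qed
qed

lemma symmetrize_nonneg: "0 \<le> symmetrize u x"
proof (cases "x = 0")
  case False
  then show ?thesis using order_refl by (rule symmetrize_gt_iff(2))
qed (simp add: symmetrize_def)

lemma level_radius:
  obtains R where "0 \<le> R" "dist_fun s = measure lborel (ball (0::'a) R)"
proof -
  define V where "V = unit_ball_vol (real DIM('a))"
  have V: "V > 0" by (simp add: V_def)
  define R where "R = root DIM('a) (dist_fun s / V)"
  have R: "R \<ge> 0" using V by (simp add: R_def real_root_ge_zero)
  have "R ^ DIM('a) = dist_fun s / V"
    using V by (simp add: R_def real_root_pow_pos2)
  then have "dist_fun s = V * R ^ DIM('a)" using V by simp
  then show ?thesis using R by (intro that[of R]) (simp_all add: content_ball V_def)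
qed

lemma ball_measure_less_iff:
  assumes "0 \<le> a" "0 \<le> b"
  shows "measure lborel (ball (0::'a) a) < measure lborel (ball (0::'a) b) \<longleftrightarrow> a < b"
proof -
  have "unit_ball_vol (real DIM('a)) > 0" by simp
  then have "measure lborel (ball (0::'a) a) < measure lborel (ball (0::'a) b) \<longleftrightarrow> a ^ DIM('a) < b ^ DIM('a)"
    using assms by (simp only: content_ball mult_less_cancel_left_pos)
  also have "\<dots> \<longleftrightarrow> a < b"
    using assms power_mono_iff[of b a "DIM('a)"] by (metis DIM_positive not_le)
  finally show ?thesis .
qed

lemma level_symmetrize:
  assumes s: "0 \<le> s" and R: "0 \<le> R" "dist_fun s = measure lborel (ball (0::'a) R)"
  shows "{x. s < symmetrize u x} = ball 0 R - {0}"
proof -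
  have "s < symmetrize u x \<longleftrightarrow> norm x < R" if "x \<noteq> 0" for x
    unfolding symmetrize_gt_iff(1)[OF that s] R(2) using R by (simp add: ball_measure_less_iff)
  then show ?thesis using s by (auto simp: symmetrize_def)
qed

lemma symmetrize_measurable [measurable]: "symmetrize u \<in> borel_measurable borel"
proof (rule borel_measurableI_greater)
  fix s :: real
  show "{x \<in> space borel. s < symmetrize u x} \<in> sets borel"
  proof (cases "s < 0")
    case True
    then have "{x. s < symmetrize u x} = UNIV"
      using symmetrize_nonneg by (auto intro: less_le_trans)
    then show ?thesis by simp
  next
    case False
    obtain R where R: "0 \<le> R" "dist_fun s = measure lborel (ball (0::'a) R)" by (rule level_radius)
    then have "{x. s < symmetrize u x} = ball 0 R - {0}" using False by (intro level_symmetrize) auto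
    then show ?thesis by simp
  qed
qed

lemma symmetrize_outside:
  assumes "dist_fun 0 \<le> measure lborel (ball (0::'a) r)" "0 \<le> r" "x \<notin> ball 0 r"
  shows "symmetrize u x = 0"
proof (cases "x = 0")
  case False
  have "\<not> measure lborel (ball (0::'a) (norm x)) < measure lborel (ball (0::'a) r)"
    using assms by (subst ball_measure_less_iff) auto
  then have "\<not> 0 < symmetrize u x"
    using assms(1) by (subst symmetrize_gt_iff[OF False]) auto
  then show ?thesis using symmetrize_nonneg[of x] by simp
qed (simp add: symmetrize_def)

lemma indicator_level_symmetrize:
  assumes "0 \<le> s" "0 \<le> R" "dist_fun s = measure lborel (ball (0::'a) R)"
  shows "AE x in lborel. indicator {x. s < symmetrize u x} x = (indicator (ball 0 R) x :: real)"
  using AE_lborel_singleton[of "0::'a"] unfolding level_symmetrize[OF assms]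
  by eventually_elim (simp add: indicator_def)

lemma emeasure_level_symmetrize:
  assumes s: "0 \<le> s"
  shows "emeasure lborel {x. s < symmetrize u x} = emeasure lborel {x. s < u x}"
proof -
  obtain R where R: "0 \<le> R" "dist_fun s = measure lborel (ball (0::'a) R)" by (rule level_radius)
  have "emeasure lborel (ball (0::'a) R - {0}) = emeasure lborel (ball (0::'a) R)"
    by (intro emeasure_Diff_null_set) (auto simp: null_sets_def)
  also have "\<dots> = emeasure lborel {x. s < u x}"
    using R(2) level_fmeasurable[OF s] by (simp add: emeasure_eq_measure2 fmeasurable_lborel_bounded[of _ R])
  finally show ?thesis by (simp add: level_symmetrize[OF s R])
qed

lemma nn_integral_symmetrize_square:
  "(\<integral>\<^sup>+x. ennreal ((symmetrize u x)\<^sup>2) \<partial>lborel) = (\<integral>\<^sup>+x. ennreal ((u x)\<^sup>2) \<partial>lborel)"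
proof -
  have *: "{x. s < (f x)\<^sup>2} = {x. sqrt s < f x}" if "\<And>x. 0 \<le> f x" "0 \<le> s" for f :: "'a \<Rightarrow> real" and s
  proof -
    have "s < (f x)\<^sup>2 \<longleftrightarrow> sqrt s < f x" for x
      using that real_sqrt_less_iff[of s "(f x)\<^sup>2"] by (simp add: real_sqrt_abs)
    then show ?thesis by simp
  qed
  have "emeasure lborel {x. s < (symmetrize u x)\<^sup>2} = emeasure lborel {x. s < (u x)\<^sup>2}" if "0 \<le> s" for s
    using that by (simp add: * symmetrize_nonneg nonneg emeasure_level_symmetrize)
  then show ?thesis
    by (subst (1 2) nn_integral_layers) (auto simp: indicator_def intro!: nn_integral_cong)
qed

lemma riesz_symmetrize:
  assumes k: "antimono k" "\<And>x. 0 \<le> k x" "\<And>x. k x \<le> K" and [measurable]: "k \<in> borel_measurable borel"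
  shows "riesz k u u \<le> riesz k (symmetrize u) (symmetrize u)"
proof -
  have lay: "riesz k f f = (\<integral>\<^sup>+s\<in>{0..}. (\<integral>\<^sup>+t\<in>{0..}. riesz k (indicator {x. t < f x}) (indicator {x. s < f x}) \<partial>lborel) \<partial>lborel)"
    if [measurable]: "f \<in> borel_measurable borel" and f: "\<And>x. 0 \<le> f x" for f :: "'a \<Rightarrow> real"
  proof -
    have [measurable]: "indicator {x. s < f x} \<in> borel_measurable borel" for s
      unfolding indicator_def by measurable
    \<comment> \<open>\<open>riesz_layers\<close> slices the first argument only; the symmetry of
      \<open>riesz\<close> brings the second one into that place.\<close>
    have "riesz k (indicator {x. s < f x}) f
      = (\<integral>\<^sup>+t\<in>{0..}. riesz k (indicator {x. t < f x}) (indicator {x. s < f x}) \<partial>lborel)" for s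
      using f by (subst riesz_commute) (auto intro: riesz_layers)
    then show ?thesis using f by (subst riesz_layers) auto
  qed
  have "riesz k (indicator {x. t < u x}) (indicator {x. s < u x})
     \<le> riesz k (indicator {x. t < symmetrize u x}) (indicator {x. s < symmetrize u x})"
    if "0 \<le> s" "0 \<le> t" for s t
  proof -
    obtain R where R: "0 \<le> R" "dist_fun s = measure lborel (ball (0::'a) R)" by (rule level_radius)
    obtain T where T: "0 \<le> T" "dist_fun t = measure lborel (ball (0::'a) T)" by (rule level_radius)
    have "riesz k (indicator {x. t < u x}) (indicator {x. s < u x}) \<le> riesz k (indicator (ball (0::'a) T)) (indicator (ball 0 R))"
    proof (rule riesz_le_balls[where M = M and K = K])
      show "{x. t < u x} \<subseteq> ball 0 M" "{x. s < u x} \<subseteq> ball 0 M"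
        using that by (simp_all add: level_subset)
    qed (use R T k level_sets in auto)
    also have "\<dots> = riesz k (indicator {x. t < symmetrize u x}) (indicator {x. s < symmetrize u x})"
      using indicator_level_symmetrize[OF that(1) R] indicator_level_symmetrize[OF that(2) T]
      by (intro riesz_cong_AE) (auto simp: eq_commute)
    finally show ?thesis .
  qed
  then show ?thesis
    unfolding lay[OF meas nonneg] lay[OF symmetrize_measurable symmetrize_nonneg]
    by (intro nn_integral_mono) (auto simp: indicator_def intro!: nn_integral_mono)
qed

end

section \<open>Near and far energy\<close>

lemma AE_norm_diff_ne:
  fixes x :: "'a::euclidean_space"
  shows "AE y in lborel. norm (x - y) \<noteq> r"
proof -
  have "sphere x r \<in> null_sets lborel"
    using negligible_sphere[of x r] by (simp add: negligible_iff_null_sets null_sets_completion_iff)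
  then show ?thesis
    by (rule AE_not_in[THEN AE_mp]) (simp add: dist_norm)
qed

lemma riesz_eq_lborel_prod:
  fixes f g :: "'a::euclidean_space \<Rightarrow> real"
  assumes [measurable]: "f \<in> borel_measurable borel" "g \<in> borel_measurable borel" "k \<in> borel_measurable borel"
  shows "riesz k f g = (\<integral>\<^sup>+(x, y). ennreal (f x * g y * k (norm (x - y))) \<partial>lborel)"
proof -
  have "(\<lambda>(x, y). ennreal (f x * g y * k (norm (x - y)))) \<in> borel_measurable (lborel \<Otimes>\<^sub>M lborel)"
    by measurable
  from lborel.nn_integral_fst[OF this] show ?thesis
    by (simp add: riesz_def lborel_prod)
qed

lemma borel_measurable_lborel_prodI:
  "f \<in> borel_measurable (lborel \<Otimes>\<^sub>M lborel) \<Longrightarrow> f \<in> borel_measurable (lborel :: ('a::euclidean_space \<times> 'b::euclidean_space) measure)"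
  by (simp add: lborel_prod)

text \<open>The kernel is a parameter because truncated kernels are inserted first and
  \<open>1 / t ^ N\<close> is recovered in the limit. The far energy below has a fixed kernel, since
  truncation does not reach distances at least 1.\<close>

definition near_energy :: "(real \<Rightarrow> real) \<Rightarrow> ('a::euclidean_space \<Rightarrow> real) \<Rightarrow> ennreal" where
  "near_energy k f = (\<integral>\<^sup>+(x, y). ennreal ((f x - f y)\<^sup>2 * k (norm (x - y))) * indicator {(x, y). norm (x - y) \<le> 1} (x, y) \<partial>lborel)"

definition far_energy :: "('a::euclidean_space \<Rightarrow> real) \<Rightarrow> ennreal" where
  "far_energy f = (\<integral>\<^sup>+(x, y). ennreal (f x * f y / norm (x - y) ^ DIM('a)) * indicator {(x, y). 1 \<le> norm (x - y)} (x, y) \<partial>lborel)"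

text \<open>The cutoff \<open>1 / Suc m\<close> is positive, so the kernel is bounded, and at most
  1, so the far region sees the original kernel. Below the cutoff the value is constant, which makes
  the function antimonotone on all reals.\<close>

definition trunc_kernel :: "nat \<Rightarrow> nat \<Rightarrow> real \<Rightarrow> real" where
  "trunc_kernel N m t = 1 / (max t (1 / Suc m)) ^ N"

lemma inverse_power_antimono: "0 < (a::real) \<Longrightarrow> a \<le> b \<Longrightarrow> 1 / b ^ N \<le> 1 / a ^ N"
  by (simp add: frac_le power_mono)

lemma trunc_cutoff_pos: "0 < max t (1 / real (Suc m))"
  by (simp add: less_max_iff_disj)

lemma trunc_kernel_measurable [measurable]: "trunc_kernel N m \<in> borel_measurable borel"
  unfolding trunc_kernel_def by measurable

lemma trunc_kernel_nonneg: "0 \<le> trunc_kernel N m t"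
  unfolding trunc_kernel_def using trunc_cutoff_pos[of t m] by simp

lemma trunc_kernel_antimono: "antimono (trunc_kernel N m)"
  unfolding trunc_kernel_def
  by (intro antimonoI inverse_power_antimono trunc_cutoff_pos) auto

lemma trunc_kernel_le: "trunc_kernel N m t \<le> real (Suc m) ^ N"
proof -
  have "1 / (max t (1 / Suc m)) ^ N \<le> 1 / (1 / Suc m) ^ N"
    by (intro inverse_power_antimono) auto
  then show ?thesis by (simp add: trunc_kernel_def power_divide)
qed

lemma trunc_kernel_eq: "1 / Suc m \<le> t \<Longrightarrow> trunc_kernel N m t = 1 / t ^ N"
  by (simp add: trunc_kernel_def max_absorb1)

lemma trunc_kernel_mono: "m \<le> n \<Longrightarrow> trunc_kernel N m t \<le> trunc_kernel N n t"
  unfolding trunc_kernel_def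
  by (intro inverse_power_antimono trunc_cutoff_pos max.mono) (auto simp: frac_le)

text \<open>Monotone convergence. Off the diagonal the supremum is attained once
  \<open>1 / Suc m < norm (x - y)\<close>; on the diagonal both integrands vanish with
  \<open>f x - f y\<close>.\<close>

lemma near_energy_eq_SUP:
  fixes f :: "'a::euclidean_space \<Rightarrow> real"
  assumes [measurable]: "f \<in> borel_measurable borel"
  shows "near_energy (\<lambda>t. 1 / t ^ DIM('a)) f = (SUP m. near_energy (trunc_kernel DIM('a) m) f)"
proof -
  define F where "F m p = ennreal ((f (fst p) - f (snd p))\<^sup>2 * trunc_kernel DIM('a) m (norm (fst p - snd p)))
      * indicator {(x, y). norm (x - y) \<le> 1} p" for m and p :: "'a \<times> 'a"
  have SUP: "ennreal ((f x - f y)\<^sup>2 * (1 / norm (x - y) ^ DIM('a))) * indicator {(x, y). norm (x - y) \<le> 1} (x, y)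
     = (SUP m. ennreal ((f x - f y)\<^sup>2 * trunc_kernel DIM('a) m (norm (x - y))) * indicator {(x, y). norm (x - y) \<le> 1} (x, y))"
     (is "?L = (SUP m. ?R m)") for x y :: 'a
  proof (cases "x = y")
    case False
    obtain m where m: "1 / Suc m < norm (x - y)"
      using reals_Archimedean[of "norm (x - y)"] False by (auto simp: inverse_eq_divide)
    have "?L = ?R m" using m by (simp add: trunc_kernel_eq)
    moreover have "?R n \<le> ?L" for n
    proof -
      have "trunc_kernel DIM('a) n (norm (x - y)) \<le> 1 / norm (x - y) ^ DIM('a)"
        unfolding trunc_kernel_def using False
        by (intro inverse_power_antimono) auto
      then show ?thesis by (intro mult_right_mono ennreal_leI mult_left_mono) auto
    qed
    ultimately show ?thesis
      by (intro antisym SUP_upper2[of m] SUP_least) auto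
  qed simp
  have "near_energy (\<lambda>t. 1 / t ^ DIM('a)) f = (\<integral>\<^sup>+p. (SUP m. F m p) \<partial>lborel)"
    unfolding near_energy_def F_def
  proof (intro nn_integral_cong)
    fix p :: "'a \<times> 'a"
    obtain x y where p: "p = (x, y)" by force
    show "(case p of (x, y) \<Rightarrow> ennreal ((f x - f y)\<^sup>2 * (1 / norm (x - y) ^ DIM('a))) * indicator {(x, y). norm (x - y) \<le> 1} (x, y))
      = (SUP m. ennreal ((f (fst p) - f (snd p))\<^sup>2 * trunc_kernel DIM('a) m (norm (fst p - snd p)))
          * indicator {(x, y). norm (x - y) \<le> 1} p)"
      unfolding p prod.case fst_conv snd_conv by (rule SUP)
  qed
  also have "\<dots> = (SUP m. \<integral>\<^sup>+p. F m p \<partial>lborel)"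
  proof (rule nn_integral_monotone_convergence_SUP)
    show "incseq F"
      unfolding F_def
      by (intro monoI le_funI mult_right_mono ennreal_leI mult_left_mono trunc_kernel_mono) auto
    show "F m \<in> borel_measurable lborel" for m
      unfolding F_def indicator_def by (rule borel_measurable_lborel_prodI) measurable
  qed
  also have "\<dots> = (SUP m. near_energy (trunc_kernel DIM('a) m) f)"
    unfolding near_energy_def F_def by (intro SUP_cong nn_integral_cong) auto
  finally show ?thesis .
qed

text \<open>The near and far regions overlap where \<open>norm (x - y) = 1\<close>. This set is
  null, and with the strict inequality the two regions partition the product space.\<close>

lemma far_energy_strict:
  fixes f :: "'a::euclidean_space \<Rightarrow> real"
  shows "far_energy f = (\<integral>\<^sup>+(x, y). ennreal (f x * f y / norm (x - y) ^ DIM('a)) * indicator {(x, y). 1 < norm (x - y)} (x, y) \<partial>lborel)"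
  unfolding far_energy_def
proof (rule nn_integral_cong_AE)
  have "{p \<in> space (lborel \<Otimes>\<^sub>M lborel). norm (fst p - snd p :: 'a) \<noteq> 1} \<in> sets (lborel \<Otimes>\<^sub>M lborel)"
    by measurable
  then have "AE p in lborel \<Otimes>\<^sub>M lborel. norm (fst p - snd p :: 'a) \<noteq> 1"
    by (rule lborel_pair.AE_pair_measure) (simp add: AE_norm_diff_ne)
  then have "AE p in lborel. norm (fst p - snd p :: 'a) \<noteq> 1"
    unfolding lborel_prod .
  then show "AE p in lborel. (case p of (x, y) \<Rightarrow> ennreal (f x * f y / norm (x - y) ^ DIM('a)) * indicator {(x, y). 1 \<le> norm (x - y)} (x, y))
     = (case p of (x, y) \<Rightarrow> ennreal (f x * f y / norm (x - y) ^ DIM('a)) * indicator {(x, y). 1 < norm (x - y)} (x, y))"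
    by eventually_elim (auto simp: indicator_def)
qed

text \<open>On the near region this is \<open>(a - b)^2 + 2 a b = a^2 + b^2\<close>, and integrating
  the kernel over the other variable gives a factor independent of the point by translation
  invariance. On the far region the Riesz integrand is that of \<open>far_energy\<close>. Writing
  the identity with sums only avoids subtraction of possibly infinite terms.\<close>

lemma near_energy_plus_riesz:
  fixes f :: "'a::euclidean_space \<Rightarrow> real" and m :: nat
  assumes [measurable]: "f \<in> borel_measurable borel" and f: "\<And>x. 0 \<le> f x"
  defines "k \<equiv> trunc_kernel DIM('a) m"
  shows "near_energy k f + 2 * riesz k f f
       = 2 * ((\<integral>\<^sup>+x. ennreal ((f x)\<^sup>2) \<partial>lborel) * (\<integral>\<^sup>+z. ennreal (k (norm (z::'a))) * indicator (cball 0 1) z \<partial>lborel))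
         + 2 * far_energy f"
proof -
  define I where "I = (indicator {(x, y). norm (x - y :: 'a) \<le> 1} :: _ \<Rightarrow> ennreal)"
  define J where "J = (indicator {(x, y). 1 < norm (x - y :: 'a)} :: _ \<Rightarrow> ennreal)"
  have [measurable]: "k \<in> borel_measurable borel" by (simp add: k_def)
  have k0: "0 \<le> k t" for t by (simp add: k_def trunc_kernel_nonneg)
  have [measurable]: "I \<in> borel_measurable (borel \<Otimes>\<^sub>M borel)" "J \<in> borel_measurable (borel \<Otimes>\<^sub>M borel)"
    unfolding I_def J_def indicator_def by measurable
  have IJ: "I p + J p = 1" for p by (auto simp: I_def J_def indicator_def split: prod.splits)
  have JI: "J (x, y) = 0 \<or> k (norm (x - y)) = 1 / norm (x - y) ^ DIM('a)" for x y
  proof (cases "1 < norm (x - y)")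
    case True
    then have "1 / Suc m \<le> norm (x - y)" by (simp add: divide_le_eq_1 order_trans[OF _ less_imp_le[OF True]])
    then show ?thesis by (simp add: k_def trunc_kernel_eq)
  qed (simp add: J_def)
  have point: "ennreal ((f x - f y)\<^sup>2 * k (norm (x - y))) * I (x, y) + 2 * ennreal (f x * f y * k (norm (x - y)))
     = (ennreal ((f x)\<^sup>2) * (ennreal (k (norm (x - y))) * I (x, y)) + ennreal ((f y)\<^sup>2) * (ennreal (k (norm (x - y))) * I (x, y)))
       + 2 * (ennreal (f x * f y / norm (x - y) ^ DIM('a)) * J (x, y))" for x y
  proof (cases "norm (x - y) \<le> 1")
    case True
    then have I: "I (x, y) = 1" "J (x, y) = 0" by (auto simp: I_def J_def)
    have "(f x - f y)\<^sup>2 * k (norm (x - y)) + 2 * (f x * f y * k (norm (x - y))) = (f x)\<^sup>2 * k (norm (x - y)) + (f y)\<^sup>2 * k (norm (x - y))"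
      by (simp add: power2_eq_square algebra_simps)
    moreover have "ennreal ((f x - f y)\<^sup>2 * k (norm (x - y))) + 2 * ennreal (f x * f y * k (norm (x - y)))
        = ennreal ((f x - f y)\<^sup>2 * k (norm (x - y)) + 2 * (f x * f y * k (norm (x - y))))"
      using f k0 by (simp add: ennreal_plus ennreal_mult')
    moreover have "ennreal ((f x)\<^sup>2) * ennreal (k (norm (x - y))) + ennreal ((f y)\<^sup>2) * ennreal (k (norm (x - y)))
        = ennreal ((f x)\<^sup>2 * k (norm (x - y)) + (f y)\<^sup>2 * k (norm (x - y)))"
      using k0 by (simp add: ennreal_plus ennreal_mult')
    ultimately show ?thesis by (simp add: I)
  next
    case False
    then have "I (x, y) = 0" "J (x, y) = 1" by (auto simp: I_def J_def)
    then show ?thesis using JI[of x y] by simp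
  qed
  define \<kappa> where "\<kappa> = (\<integral>\<^sup>+z. ennreal (k (norm (z::'a))) * indicator (cball 0 1) z \<partial>lborel)"
  have \<kappa>: "(\<integral>\<^sup>+y. ennreal (k (norm (x - y))) * I (x, y) \<partial>lborel) = \<kappa>" for x
  proof -
    have "(\<integral>\<^sup>+y. ennreal (k (norm (x - y))) * I (x, y) \<partial>lborel)
        = (\<integral>\<^sup>+y. ennreal (k (norm (x - (x + y)))) * I (x, x + y) \<partial>lborel)"
      by (rule nn_integral_lborel_translate[symmetric]) measurable
    also have "\<dots> = \<kappa>"
      unfolding \<kappa>_def by (intro nn_integral_cong) (simp add: I_def indicator_def)
    finally show ?thesis .
  qed
  have int1: "(\<integral>\<^sup>+(x, y). ennreal ((f x)\<^sup>2) * (ennreal (k (norm (x - y))) * I (x, y)) \<partial>lborel) = (\<integral>\<^sup>+x. ennreal ((f x)\<^sup>2) \<partial>lborel) * \<kappa>"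
  proof -
    have m: "(\<lambda>(x, y). ennreal ((f x)\<^sup>2) * (ennreal (k (norm (x - y))) * I (x, y))) \<in> borel_measurable (lborel \<Otimes>\<^sub>M lborel)"
      by measurable
    show ?thesis
      using lborel.nn_integral_fst[OF m] by (simp add: lborel_prod nn_integral_cmult \<kappa> nn_integral_multc)
  qed
  have int2: "(\<integral>\<^sup>+(x, y). ennreal ((f y)\<^sup>2) * (ennreal (k (norm (x - y))) * I (x, y)) \<partial>lborel) = (\<integral>\<^sup>+x. ennreal ((f x)\<^sup>2) \<partial>lborel) * \<kappa>"
  proof -
    have m: "(\<lambda>(x, y). ennreal ((f y)\<^sup>2) * (ennreal (k (norm (x - y))) * I (x, y))) \<in> borel_measurable (lborel \<Otimes>\<^sub>M lborel)"
      by measurable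
    have "I (x, y) = I (y, x)" for x y by (auto simp: I_def indicator_def norm_minus_commute)
    then have \<kappa>': "(\<integral>\<^sup>+x. ennreal (k (norm (x - y))) * I (x, y) \<partial>lborel) = \<kappa>" for y
      using \<kappa>[of y] by (simp add: norm_minus_commute)
    show ?thesis
      using lborel_pair.nn_integral_snd[OF m] by (simp add: lborel_prod nn_integral_cmult \<kappa>' nn_integral_multc)
  qed
  define a b c\<^sub>1 c\<^sub>2 d where abcd:
      "a p = ennreal ((f (fst p) - f (snd p))\<^sup>2 * k (norm (fst p - snd p))) * I p"
      "b p = ennreal (f (fst p) * f (snd p) * k (norm (fst p - snd p)))"
      "c\<^sub>1 p = ennreal ((f (fst p))\<^sup>2) * (ennreal (k (norm (fst p - snd p))) * I p)"
      "c\<^sub>2 p = ennreal ((f (snd p))\<^sup>2) * (ennreal (k (norm (fst p - snd p))) * I p)"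
      "d p = ennreal (f (fst p) * f (snd p) / norm (fst p - snd p) ^ DIM('a)) * J p" for p
  have [measurable]: "a \<in> borel_measurable lborel"
    unfolding abcd by (rule borel_measurable_lborel_prodI) measurable
  have [measurable]: "b \<in> borel_measurable lborel"
    unfolding abcd by (rule borel_measurable_lborel_prodI) measurable
  have [measurable]: "c\<^sub>1 \<in> borel_measurable lborel"
    unfolding abcd by (rule borel_measurable_lborel_prodI) measurable
  have [measurable]: "c\<^sub>2 \<in> borel_measurable lborel"
    unfolding abcd by (rule borel_measurable_lborel_prodI) measurable
  have [measurable]: "d \<in> borel_measurable lborel"
    unfolding abcd by (rule borel_measurable_lborel_prodI) measurable
  have "near_energy k f = (\<integral>\<^sup>+p. a p \<partial>lborel)"
    unfolding near_energy_def abcd I_def by (intro nn_integral_cong) auto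
  moreover have "riesz k f f = (\<integral>\<^sup>+p. b p \<partial>lborel)"
    unfolding abcd by (subst riesz_eq_lborel_prod) (auto intro!: nn_integral_cong)
  moreover have "far_energy f = (\<integral>\<^sup>+p. d p \<partial>lborel)"
    unfolding far_energy_strict abcd J_def by (intro nn_integral_cong) auto
  moreover have "(\<integral>\<^sup>+p. c\<^sub>1 p \<partial>lborel) = (\<integral>\<^sup>+x. ennreal ((f x)\<^sup>2) \<partial>lborel) * \<kappa>"
    unfolding int1[symmetric] abcd by (intro nn_integral_cong) auto
  moreover have "(\<integral>\<^sup>+p. c\<^sub>2 p \<partial>lborel) = (\<integral>\<^sup>+x. ennreal ((f x)\<^sup>2) \<partial>lborel) * \<kappa>"
    unfolding int2[symmetric] abcd by (intro nn_integral_cong) auto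
  moreover have "(\<integral>\<^sup>+p. a p \<partial>lborel) + 2 * (\<integral>\<^sup>+p. b p \<partial>lborel)
      = (\<integral>\<^sup>+p. c\<^sub>1 p \<partial>lborel) + (\<integral>\<^sup>+p. c\<^sub>2 p \<partial>lborel) + 2 * (\<integral>\<^sup>+p. d p \<partial>lborel)"
  proof -
    have "a p + 2 * b p = c\<^sub>1 p + c\<^sub>2 p + 2 * d p" for p
      using point[of "fst p" "snd p"] by (simp add: abcd)
    then have "(\<integral>\<^sup>+p. a p + 2 * b p \<partial>lborel) = (\<integral>\<^sup>+p. c\<^sub>1 p + c\<^sub>2 p + 2 * d p \<partial>lborel)" by simp
    then show ?thesis by (simp add: nn_integral_add nn_integral_cmult)
  qed
  ultimately show ?thesis by (simp add: \<kappa>_def mult_2)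
qed

section \<open>Finiteness of the energies and their behaviour under symmetrization\<close>

abbreviation log_near_energy :: "('a::euclidean_space \<Rightarrow> real) \<Rightarrow> ennreal" where
  "log_near_energy \<equiv> near_energy (\<lambda>t. 1 / t ^ DIM('a))"

lemma nn_integral_prod_square:
  fixes f :: "'a::euclidean_space \<Rightarrow> real"
  assumes [measurable]: "f \<in> borel_measurable borel" and f: "\<And>x. 0 \<le> f x"
  shows "(\<integral>\<^sup>+x. \<integral>\<^sup>+y. ennreal (f x * f y) \<partial>lborel \<partial>lborel) = (\<integral>\<^sup>+x. ennreal (f x) \<partial>lborel)\<^sup>2"
  using f by (simp add: ennreal_mult' nn_integral_cmult nn_integral_multc power2_eq_square)

text \<open>The kernel is at most 1 on the far region. The bound yields finiteness of the far energy
  and, later, the lower bound for the form.\<close>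

lemma far_energy_le:
  fixes f :: "'a::euclidean_space \<Rightarrow> real"
  assumes [measurable]: "f \<in> borel_measurable borel" and f: "\<And>x. 0 \<le> f x"
  shows "far_energy f \<le> (\<integral>\<^sup>+x. ennreal (f x) \<partial>lborel)\<^sup>2"
proof -
  have "far_energy f \<le> (\<integral>\<^sup>+(x, y). ennreal (f x * f y) \<partial>lborel)"
    unfolding far_energy_def
  proof (rule nn_integral_mono)
    fix p :: "'a \<times> 'a"
    obtain x y where p: "p = (x, y)" by force
    have "f x * f y / norm (x - y) ^ DIM('a) \<le> f x * f y / 1" if "1 \<le> norm (x - y)"
    proof (intro divide_left_mono mult_pos_pos zero_less_power)
      show "0 < norm (x - y)" using that by linarith
    qed (use f that in auto)
    then show "(case p of (x, y) \<Rightarrow> ennreal (f x * f y / norm (x - y) ^ DIM('a)) * indicator {(x, y). 1 \<le> norm (x - y)} (x, y))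
      \<le> (case p of (x, y) \<Rightarrow> ennreal (f x * f y))"
      by (auto simp: p indicator_def intro!: ennreal_leI)
  qed
  also have "\<dots> = riesz (\<lambda>_. 1) f f"
    by (subst riesz_eq_lborel_prod) simp_all
  also have "\<dots> = (\<integral>\<^sup>+x. ennreal (f x) \<partial>lborel)\<^sup>2"
    using f by (simp add: riesz_def nn_integral_prod_square)
  finally show ?thesis .
qed

lemma riesz_le_square:
  fixes f :: "'a::euclidean_space \<Rightarrow> real"
  assumes [measurable]: "f \<in> borel_measurable borel" and f: "\<And>x. 0 \<le> f x"
    and k: "\<And>t. 0 \<le> k t" "\<And>t. k t \<le> K"
  shows "riesz k f f \<le> ennreal K * (\<integral>\<^sup>+x. ennreal (f x) \<partial>lborel)\<^sup>2"
proof -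
  have K: "0 \<le> K" using k[of 0] by linarith
  have "riesz k f f \<le> (\<integral>\<^sup>+x. \<integral>\<^sup>+y. ennreal K * ennreal (f x * f y) \<partial>lborel \<partial>lborel)"
    unfolding riesz_def
  proof (intro nn_integral_mono)
    fix x y
    have "f x * f y * k (norm (x - y)) \<le> f x * f y * K"
      using f k by (intro mult_left_mono) auto
    then show "ennreal (f x * f y * k (norm (x - y))) \<le> ennreal K * ennreal (f x * f y)"
      using K by (simp add: mult.commute ennreal_leI flip: ennreal_mult')
  qed
  also have "\<dots> = ennreal K * (\<integral>\<^sup>+x. ennreal (f x) \<partial>lborel)\<^sup>2"
    using f by (simp add: nn_integral_cmult nn_integral_prod_square)
  finally show ?thesis .
qed

context symmetrizable
begin

text \<open>The elementary bound \<open>t \<le> 1 + t^2\<close>, used only inside the support, turns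
  square integrability into integrability.\<close>

lemma nn_integral_le_square:
  "(\<integral>\<^sup>+x. ennreal (u x) \<partial>lborel) \<le> emeasure lborel (ball (0::'a) M) + (\<integral>\<^sup>+x. ennreal ((u x)\<^sup>2) \<partial>lborel)"
proof -
  have le: "u x \<le> indicator (ball 0 M) x + (u x)\<^sup>2" for x
  proof (cases "x \<in> ball 0 M")
    case True
    have "0 \<le> (u x - 1 / 2)\<^sup>2" by simp
    then have "u x \<le> 1 + (u x)\<^sup>2" by (simp add: power2_eq_square algebra_simps)
    then show ?thesis using True by simp
  qed (simp add: outside)
  have "(\<integral>\<^sup>+x. ennreal (u x) \<partial>lborel) \<le> (\<integral>\<^sup>+x. indicator (ball 0 M) x + ennreal ((u x)\<^sup>2) \<partial>lborel)"
  proof (intro nn_integral_mono)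
    fix x
    have "ennreal (u x) \<le> ennreal (indicator (ball 0 M) x + (u x)\<^sup>2)" by (intro ennreal_leI le)
    then show "ennreal (u x) \<le> indicator (ball 0 M) x + ennreal ((u x)\<^sup>2)"
      by (simp add: ennreal_plus ennreal_indicator)
  qed
  also have "\<dots> = (\<integral>\<^sup>+x. indicator (ball (0::'a) M) x \<partial>lborel) + (\<integral>\<^sup>+x. ennreal ((u x)\<^sup>2) \<partial>lborel)"
    by (rule nn_integral_add) (auto intro!: borel_measurable_indicator)
  finally show ?thesis by simp
qed

lemma finite_integrals:
  assumes S: "(\<integral>\<^sup>+x. ennreal ((u x)\<^sup>2) \<partial>lborel) < \<infinity>"
  shows "(\<integral>\<^sup>+x. ennreal (u x) \<partial>lborel) < \<infinity>" "far_energy u < \<infinity>"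
    "riesz (trunc_kernel N m) u u < \<infinity>"
proof -
  have "emeasure lborel (ball (0::'a) M) + (\<integral>\<^sup>+x. ennreal ((u x)\<^sup>2) \<partial>lborel) < \<infinity>"
    using S emeasure_lborel_ball_finite[of "0::'a" M] by simp
  then show 1: "(\<integral>\<^sup>+x. ennreal (u x) \<partial>lborel) < \<infinity>"
    by (rule le_less_trans[OF nn_integral_le_square])
  then have 2: "(\<integral>\<^sup>+x. ennreal (u x) \<partial>lborel)\<^sup>2 < \<infinity>"
    by (simp add: power2_eq_square ennreal_mult_less_top)
  show "far_energy u < \<infinity>" using far_energy_le[OF meas nonneg] 2 by (rule le_less_trans)
  have "riesz (trunc_kernel N m) u u \<le> ennreal (real (Suc m) ^ N) * (\<integral>\<^sup>+x. ennreal (u x) \<partial>lborel)\<^sup>2"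
    using trunc_kernel_nonneg trunc_kernel_le by (intro riesz_le_square meas nonneg)
  also have "\<dots> < \<infinity>" using 2 by (simp add: ennreal_mult_less_top)
  finally show "riesz (trunc_kernel N m) u u < \<infinity>" .
qed

lemma symmetrizable_symmetrize:
  assumes "dist_fun 0 \<le> measure lborel (ball (0::'a) r)" "0 \<le> r"
  shows "symmetrizable (symmetrize u) r"
proof
  show "symmetrize u x = 0" if "x \<notin> ball 0 r" for x
    using assms that by (rule symmetrize_outside)
qed (simp_all add: symmetrize_nonneg)

text \<open>Subtracting the identities of \<open>near_energy_plus_riesz\<close> for \<open>u\<close>
  and \<open>symmetrize u\<close>, the square terms agree and Riesz' inequality decides the sign.
  The Riesz term of \<open>symmetrize u\<close> is finite for the truncated kernel, so it may be
  cancelled in \<open>ennreal\<close>.\<close>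

lemma energy_symmetrize:
  assumes S: "(\<integral>\<^sup>+x. ennreal ((u x)\<^sup>2) \<partial>lborel) < \<infinity>"
  shows "log_near_energy (symmetrize u) + 2 * far_energy u \<le> log_near_energy u + 2 * far_energy (symmetrize u)"
proof -
  obtain R where R: "0 \<le> R" "dist_fun 0 = measure lborel (ball (0::'a) R)" by (rule level_radius)
  interpret w: symmetrizable "symmetrize u" R
    using R by (intro symmetrizable_symmetrize) auto
  have "near_energy (trunc_kernel DIM('a) m) (symmetrize u) + 2 * far_energy u
      \<le> near_energy (trunc_kernel DIM('a) m) u + 2 * far_energy (symmetrize u)" for m
  proof -
    define k where "k = trunc_kernel DIM('a) m"
    have rle: "riesz k u u \<le> riesz k (symmetrize u) (symmetrize u)"
      unfolding k_def by (rule riesz_symmetrize[OF trunc_kernel_antimono trunc_kernel_nonneg trunc_kernel_le]) simp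
    have fin: "2 * riesz k (symmetrize u) (symmetrize u) < \<infinity>"
      using w.finite_integrals(3) S unfolding k_def
      by (simp add: nn_integral_symmetrize_square ennreal_mult_less_top)
    have eq: "near_energy k (symmetrize u) + 2 * riesz k (symmetrize u) (symmetrize u) + 2 * far_energy u
        = near_energy k u + 2 * riesz k u u + 2 * far_energy (symmetrize u)"
      unfolding k_def near_energy_plus_riesz[OF meas nonneg]
        near_energy_plus_riesz[OF symmetrize_measurable symmetrize_nonneg] nn_integral_symmetrize_square
      by (simp add: ac_simps)
    have "2 * riesz k (symmetrize u) (symmetrize u) + (near_energy k (symmetrize u) + 2 * far_energy u)
        = near_energy k u + 2 * riesz k u u + 2 * far_energy (symmetrize u)"
      unfolding eq[symmetric] by (simp add: ac_simps)
    also have "\<dots> \<le> near_energy k u + 2 * riesz k (symmetrize u) (symmetrize u) + 2 * far_energy (symmetrize u)"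
      using rle by (intro add_mono mult_left_mono) auto
    also have "\<dots> = 2 * riesz k (symmetrize u) (symmetrize u) + (near_energy k u + 2 * far_energy (symmetrize u))"
      by (simp add: ac_simps)
    finally show ?thesis
      using fin unfolding k_def[symmetric] by (subst (asm) ennreal_add_left_cancel_le) auto
  qed
  \<comment> \<open>Enlarging the right side to the full energy frees it of \<open>m\<close>; then
    the supremum is taken on the left.\<close>
  also have "near_energy (trunc_kernel DIM('a) m) u + 2 * far_energy (symmetrize u)
      \<le> log_near_energy u + 2 * far_energy (symmetrize u)" for m
    unfolding near_energy_eq_SUP[OF meas] by (intro add_right_mono SUP_upper) simp
  finally have "(SUP m. near_energy (trunc_kernel DIM('a) m) (symmetrize u) + 2 * far_energy u)
      \<le> log_near_energy u + 2 * far_energy (symmetrize u)"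
    by (intro SUP_least)
  then show ?thesis
    by (simp add: near_energy_eq_SUP ennreal_SUP_add_left)
qed

end

section \<open>The quadratic form and its values\<close>

text \<open>Lebesgue measure is complete, so \<open>F\<close> is measurable merely by agreeing a.e.
  with a Borel function. This transfers integrals on the product space without a separate
  measurability argument for Lebesgue measurable \<open>u\<close>.\<close>

lemma integral_lebesgue_eq_lborel:
  fixes F G :: "'a::euclidean_space \<Rightarrow> real"
  assumes G: "G \<in> borel_measurable lborel" and ae: "AE x in lborel. F x = G x"
  shows "integral\<^sup>L lebesgue F = integral\<^sup>L lborel G"
proof -
  have ae': "AE x in lebesgue. F x = G x" using ae by (rule AE_completion)
  have G': "G \<in> borel_measurable lebesgue" using G by (rule measurable_completion)
  have F: "F \<in> borel_measurable lebesgue"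
  proof (rule borel_measurableI_greater)
    fix a
    have "AE x in lebesgue. x \<in> {x. a < G x} \<longleftrightarrow> x \<in> {x. a < F x}"
      using ae' by eventually_elim simp
    moreover have "{x. a < G x} \<in> sets lebesgue"
      using borel_measurable_less[OF borel_measurable_const G', of a] by simp
    ultimately show "{x \<in> space lebesgue. a < F x} \<in> sets lebesgue"
      using completion.in_sets_AE[of "{x. a < G x}" "{x. a < F x}" lborel] by simp
  qed
  have "integral\<^sup>L lebesgue F = integral\<^sup>L lebesgue G"
    using F G' ae' by (rule integral_cong_AE)
  also have "\<dots> = integral\<^sup>L lborel G" using G by (rule integral_completion)
  finally show ?thesis .
qed

text \<open>A Borel null set containing the exceptional points is chosen first, so that the
  exceptional set in the product is measurable and Fubini applies.\<close>

lemma AE_lborel_prod_both: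
  fixes P :: "'a::euclidean_space \<Rightarrow> bool"
  assumes "AE x in lborel. P x"
  shows "AE p in (lborel :: ('a \<times> 'a) measure). P (fst p) \<and> P (snd p)"
proof -
  obtain N where N: "{x. \<not> P x} \<subseteq> N" "emeasure lborel N = 0" "N \<in> sets lborel"
    using assms by (auto elim!: AE_E)
  have [measurable]: "N \<in> sets borel" using N(3) by simp
  have nN: "AE x in lborel. x \<notin> N" using N by (intro AE_not_in) (simp add: null_sets_def)
  have "{p \<in> space (lborel \<Otimes>\<^sub>M lborel). fst p \<notin> N \<and> snd p \<notin> N} \<in> sets (lborel \<Otimes>\<^sub>M lborel)"
    by measurable
  then have "AE p in lborel \<Otimes>\<^sub>M lborel. fst p \<notin> N \<and> snd p \<notin> N"
  proof (rule lborel_pair.AE_pair_measure)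
    show "AE x in lborel. AE y in lborel. fst (x, y) \<notin> N \<and> snd (x, y) \<notin> N"
      using nN
    proof eventually_elim
      case (elim x)
      show ?case using nN by eventually_elim (use elim in simp)
    qed
  qed
  then have "AE p in (lborel :: ('a \<times> 'a) measure). fst p \<notin> N \<and> snd p \<notin> N"
    unfolding lborel_prod .
  then show ?thesis by eventually_elim (use N(1) in auto)
qed

lemma enn2real_eq_1: "enn2real x = 1 \<Longrightarrow> x = 1"
  by (cases x rule: ennreal_cases) auto

lemma log_lap_c_pos: "0 < log_lap_c DIM('a::euclidean_space)"
  by (simp add: log_lap_c_def Gamma_real_pos)

text \<open>For Borel \<open>f \<ge> 0\<close> with unit square integral this is
  \<open>log_lap_form f f\<close>; the last term carries the factor 1 from that
  normalization.\<close>

definition reduced_form :: "('a::euclidean_space \<Rightarrow> real) \<Rightarrow> real" where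
  "reduced_form f = log_lap_c DIM('a) / 2 * enn2real (log_near_energy f)
     - log_lap_c DIM('a) * enn2real (far_energy f) + log_lap_rho DIM('a)"

lemma near_integral_eq:
  fixes u g :: "'a::euclidean_space \<Rightarrow> real"
  assumes [measurable]: "g \<in> borel_measurable borel" and ae: "AE x in lborel. u x = g x"
  shows "(LINT (x, y):{(x, y). norm (x - y) \<le> 1}|lebesgue. (u x - u y) * (u x - u y) / norm (x - y) ^ DIM('a))
      = enn2real (log_near_energy g)"
proof -
  define G where "G p = indicator {(x, y). norm (x - y) \<le> 1} p * ((g (fst p) - g (snd p))\<^sup>2 * (1 / norm (fst p - snd p) ^ DIM('a)))" for p :: "'a \<times> 'a"
  have G: "G \<in> borel_measurable lborel"
    unfolding G_def indicator_def by (rule borel_measurable_lborel_prodI) measurable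
  have "(LINT (x, y):{(x, y). norm (x - y) \<le> 1}|lebesgue. (u x - u y) * (u x - u y) / norm (x - y) ^ DIM('a))
      = integral\<^sup>L lborel G"
    unfolding set_lebesgue_integral_def
  proof (rule integral_lebesgue_eq_lborel[OF G])
    show "AE p in lborel. indicator {(x, y). norm (x - y) \<le> 1} p *\<^sub>R (case p of (x, y) \<Rightarrow> (u x - u y) * (u x - u y) / norm (x - y) ^ DIM('a)) = G p"
      using AE_lborel_prod_both[OF ae] by eventually_elim (auto simp: G_def power2_eq_square)
  qed
  also have "\<dots> = enn2real (\<integral>\<^sup>+p. ennreal (G p) \<partial>lborel)"
    using G by (rule integral_eq_nn_integral) (auto simp: G_def)
  also have "(\<integral>\<^sup>+p. ennreal (G p) \<partial>lborel) = log_near_energy g"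
    unfolding near_energy_def by (intro nn_integral_cong) (auto simp: G_def indicator_def)
  finally show ?thesis .
qed

lemma far_integral_eq:
  fixes u g :: "'a::euclidean_space \<Rightarrow> real"
  assumes [measurable]: "g \<in> borel_measurable borel" and ae: "AE x in lborel. u x = g x"
  shows "(LINT (x, y):{(x, y). norm (x - y) \<ge> 1}|lebesgue. u x * u y / norm (x - y) ^ DIM('a))
      = (\<integral>p. indicator {(x, y). norm (x - y) \<ge> 1} p * (g (fst p) * g (snd p) / norm (fst p - snd p) ^ DIM('a)) \<partial>lborel)"
  unfolding set_lebesgue_integral_def
proof (rule integral_lebesgue_eq_lborel)
  show "(\<lambda>p. indicator {(x, y). norm (x - y) \<ge> 1} p * (g (fst p) * g (snd p) / norm (fst p - snd p) ^ DIM('a))) \<in> borel_measurable lborel"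
    unfolding indicator_def by (rule borel_measurable_lborel_prodI) measurable
  show "AE p in lborel. indicator {(x, y). norm (x - y) \<ge> 1} p *\<^sub>R (case p of (x, y) \<Rightarrow> u x * u y / norm (x - y) ^ DIM('a))
      = indicator {(x, y). norm (x - y) \<ge> 1} p * (g (fst p) * g (snd p) / norm (fst p - snd p) ^ DIM('a))"
    using AE_lborel_prod_both[OF ae] by eventually_elim auto
qed

text \<open>The far part enters the form with a minus sign, so an upper bound by the energy of
  \<open>\<bar>g\<bar>\<close> is the direction in which passing to absolute values lowers the
  form.\<close>

lemma far_integral_abs_le:
  fixes g :: "'a::euclidean_space \<Rightarrow> real"
  assumes [measurable]: "g \<in> borel_measurable borel"
  defines "I \<equiv> (\<integral>p. indicator {(x, y). norm (x - y) \<ge> 1} p * (g (fst p) * g (snd p) / norm (fst p - snd p) ^ DIM('a)) \<partial>lborel)"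
  shows "I \<le> enn2real (far_energy (\<lambda>x. \<bar>g x\<bar>))" and "(\<And>x. 0 \<le> g x) \<Longrightarrow> I = enn2real (far_energy g)"
proof -
  define G where "G p = indicator {(x, y). norm (x - y) \<ge> 1} p * (g (fst p) * g (snd p) / norm (fst p - snd p) ^ DIM('a))" for p :: "'a \<times> 'a"
  have G: "G \<in> borel_measurable lborel"
    unfolding G_def indicator_def by (rule borel_measurable_lborel_prodI) measurable
  have I: "I = integral\<^sup>L lborel G" by (simp only: I_def G_def[abs_def])
  have "norm (integral\<^sup>L lborel G) \<le> (\<integral>p. norm (G p) \<partial>lborel)" by (rule integral_norm_bound)
  also have "\<dots> = enn2real (\<integral>\<^sup>+p. ennreal (norm (G p)) \<partial>lborel)"
    using G by (intro integral_eq_nn_integral) auto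
  also have "(\<integral>\<^sup>+p. ennreal (norm (G p)) \<partial>lborel) = far_energy (\<lambda>x. \<bar>g x\<bar>)"
    unfolding far_energy_def by (intro nn_integral_cong) (auto simp: G_def indicator_def abs_mult)
  finally show "I \<le> enn2real (far_energy (\<lambda>x. \<bar>g x\<bar>))" by (simp add: I)
  assume g: "\<And>x. 0 \<le> g x"
  have "I = enn2real (\<integral>\<^sup>+p. ennreal (G p) \<partial>lborel)"
    unfolding I using G g by (intro integral_eq_nn_integral) (auto simp: G_def)
  also have "(\<integral>\<^sup>+p. ennreal (G p) \<partial>lborel) = far_energy g"
    unfolding far_energy_def by (intro nn_integral_cong) (auto simp: G_def indicator_def)
  finally show "I = enn2real (far_energy g)" .
qed

lemma near_energy_abs_le:
  fixes g :: "'a::euclidean_space \<Rightarrow> real"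
  shows "log_near_energy (\<lambda>x. \<bar>g x\<bar>) \<le> log_near_energy g"
  unfolding near_energy_def
proof (rule nn_integral_mono, clarify)
  fix x y :: 'a
  have "\<bar>\<bar>g x\<bar> - \<bar>g y\<bar>\<bar> \<le> \<bar>g x - g y\<bar>" by simp
  then have "(\<bar>g x\<bar> - \<bar>g y\<bar>)\<^sup>2 \<le> (g x - g y)\<^sup>2" by (simp add: abs_le_square_iff)
  then show "ennreal ((\<bar>g x\<bar> - \<bar>g y\<bar>)\<^sup>2 * (1 / norm (x - y) ^ DIM('a))) * indicator {(x, y). norm (x - y) \<le> 1} (x, y)
      \<le> ennreal ((g x - g y)\<^sup>2 * (1 / norm (x - y) ^ DIM('a))) * indicator {(x, y). norm (x - y) \<le> 1} (x, y)"
    by (intro mult_right_mono ennreal_leI) auto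
qed

lemma near_nn_integral_eq:
  fixes u g :: "'a::euclidean_space \<Rightarrow> real"
  assumes ae: "AE x in lborel. u x = g x"
  shows "(\<integral>\<^sup>+(x, y)\<in>{(x, y). norm (x - y) \<le> 1}. ennreal ((u x - u y)\<^sup>2 / norm (x - y) ^ DIM('a)) \<partial>lebesgue)
     = log_near_energy g"
  unfolding near_energy_def nn_integral_completion
proof (rule nn_integral_cong_AE)
  show "AE p in lborel. (case p of (x, y) \<Rightarrow> ennreal ((u x - u y)\<^sup>2 / norm (x - y) ^ DIM('a))) * indicator {(x, y). norm (x - y) \<le> 1} p
      = (case p of (x, y) \<Rightarrow> ennreal ((g x - g y)\<^sup>2 * (1 / norm (x - y) ^ DIM('a))) * indicator {(x, y). norm (x - y) \<le> 1} (x, y))"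
    using AE_lborel_prod_both[OF ae] by eventually_elim auto
qed

lemma
  fixes u g :: "'a::euclidean_space \<Rightarrow> real"
  assumes [measurable]: "g \<in> borel_measurable borel" and ae: "AE x in lborel. u x = g x"
    and u: "\<And>x. x \<notin> \<Omega> \<Longrightarrow> u x = 0"
  shows L2_norm_eq_1_iff: "L2_norm \<Omega> u = 1 \<longleftrightarrow> (\<integral>\<^sup>+x. ennreal ((g x)\<^sup>2) \<partial>lborel) = 1"
    and integral_square_eq: "(LINT x|lebesgue. u x * u x) = enn2real (\<integral>\<^sup>+x. ennreal ((g x)\<^sup>2) \<partial>lborel)"
proof -
  have "(LINT x|lebesgue. u x * u x) = (\<integral>x. (g x)\<^sup>2 \<partial>lborel)"
    using ae by (intro integral_lebesgue_eq_lborel) (auto elim!: eventually_mono simp: power2_eq_square)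
  also have "\<dots> = enn2real (\<integral>\<^sup>+x. ennreal ((g x)\<^sup>2) \<partial>lborel)"
    by (intro integral_eq_nn_integral) auto
  finally show 1: "(LINT x|lebesgue. u x * u x) = enn2real (\<integral>\<^sup>+x. ennreal ((g x)\<^sup>2) \<partial>lborel)" .
  have "indicator \<Omega> x *\<^sub>R (u x)\<^sup>2 = u x * u x" for x
    using u[of x] by (auto simp: indicator_def power2_eq_square)
  then have "L2_norm \<Omega> u = sqrt (LINT x|lebesgue. u x * u x)"
    unfolding L2_norm_def set_lebesgue_integral_def by simp
  then show "L2_norm \<Omega> u = 1 \<longleftrightarrow> (\<integral>\<^sup>+x. ennreal ((g x)\<^sup>2) \<partial>lborel) = 1"
    unfolding 1 by (auto dest: enn2real_eq_1)
qed

text \<open>The witness is the absolute value of a Borel representative of \<open>u\<close>. Taking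
  absolute values keeps the square integral, does not increase the near energy (reverse triangle
  inequality) and does not decrease the far part.\<close>

lemma log_lap_form_ge_reduced_form:
  fixes u :: "'a::euclidean_space \<Rightarrow> real"
  assumes \<Omega>: "open \<Omega>" "\<Omega> \<subseteq> ball 0 M" and u: "u \<in> log_lap_space \<Omega>" "L2_norm \<Omega> u = 1"
  shows "\<exists>f. symmetrizable f M \<and> (\<forall>x. x \<notin> \<Omega> \<longrightarrow> f x = 0) \<and>
    (\<integral>\<^sup>+x. ennreal ((f x)\<^sup>2) \<partial>lborel) = 1 \<and> log_near_energy f < \<infinity> \<and> reduced_form f \<le> log_lap_form u u"
proof -
  have um: "u \<in> borel_measurable lebesgue" and u0: "\<And>x. x \<notin> \<Omega> \<Longrightarrow> u x = 0"
    and ufin: "(\<integral>\<^sup>+(x, y)\<in>{(x, y). norm (x - y) \<le> 1}. ennreal ((u x - u y)\<^sup>2 / norm (x - y) ^ DIM('a)) \<partial>lebesgue) < \<infinity>"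
    using u(1) by (auto simp: log_lap_space_def)
  obtain h where h: "h \<in> borel_measurable lborel" "AE x in lborel. u x = h x"
    using completion_ex_borel_measurable_real[OF um] by blast
  have [measurable]: "h \<in> borel_measurable borel" "\<Omega> \<in> sets borel" using h(1) \<Omega> by auto
  \<comment> \<open>A Borel representative need not vanish at every point outside
    \<open>\<Omega>\<close>; the indicator restores this without changing it a.e.\<close>
  define g where "g x = h x * indicator \<Omega> x" for x
  have g[measurable]: "g \<in> borel_measurable borel" unfolding g_def by measurable
  have ae: "AE x in lborel. u x = g x"
    using h(2) by eventually_elim (use u0 in \<open>auto simp: g_def indicator_def\<close>)
  define f where "f x = \<bar>g x\<bar>" for x
  have f[measurable]: "f \<in> borel_measurable borel" unfolding f_def by measurable
  have f0: "f x = 0" if "x \<notin> \<Omega>" for x using that by (simp add: f_def g_def)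
  have sym: "symmetrizable f M"
  proof
    show "f x = 0" if "x \<notin> ball 0 M" for x using that \<Omega>(2) by (intro f0) blast
  qed (simp_all add: f, simp add: f_def)
  have S: "(\<integral>\<^sup>+x. ennreal ((g x)\<^sup>2) \<partial>lborel) = 1"
    using u(2) L2_norm_eq_1_iff[OF g ae u0] by simp
  then have Sf: "(\<integral>\<^sup>+x. ennreal ((f x)\<^sup>2) \<partial>lborel) = 1" by (simp add: f_def)
  have ng: "log_near_energy g < \<infinity>" using ufin near_nn_integral_eq[OF ae] by simp
  have nfg: "log_near_energy f \<le> log_near_energy g"
    using near_energy_abs_le[of g] by (simp add: f_def[abs_def])
  then have nf: "log_near_energy f < \<infinity>" using ng by (rule le_less_trans)
  have Su: "(LINT x|lebesgue. u x * u x) = 1"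
    using integral_square_eq[OF g ae, of \<Omega>] u0 S by simp
  have c: "0 < log_lap_c DIM('a)" by (rule log_lap_c_pos)
  have n: "enn2real (log_near_energy f) \<le> enn2real (log_near_energy g)"
    using nfg ng by (intro enn2real_mono) auto
  have "reduced_form f \<le> log_lap_form u u"
    unfolding reduced_form_def log_lap_form_def near_integral_eq[OF g ae] far_integral_eq[OF g ae] Su
    using c n far_integral_abs_le(1)[OF g]
    by (intro add_mono diff_mono mult_left_mono) (auto simp: f_def[abs_def])
  then show ?thesis using sym f0 Sf nf by blast
qed

lemma reduced_form_in_log_lap_values:
  fixes w :: "'a::euclidean_space \<Rightarrow> real"
  assumes w[measurable]: "w \<in> borel_measurable borel" and w0: "\<And>x. 0 \<le> w x" "\<And>x. x \<notin> \<Omega> \<Longrightarrow> w x = 0"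
    and S: "(\<integral>\<^sup>+x. ennreal ((w x)\<^sup>2) \<partial>lborel) = 1" and n: "log_near_energy w < \<infinity>"
  shows "reduced_form w \<in> log_lap_values \<Omega>"
proof -
  have ae: "AE x in lborel. w x = w x" by simp
  have Sw: "(LINT x|lebesgue. w x * w x) = 1"
    using integral_square_eq[OF w ae, of \<Omega>] w0(2) S by simp
  have "reduced_form w = log_lap_form w w"
    unfolding reduced_form_def log_lap_form_def near_integral_eq[OF w ae] far_integral_eq[OF w ae]
      far_integral_abs_le(2)[OF w w0(1)] Sw by simp
  moreover have "w \<in> log_lap_space \<Omega>"
    unfolding log_lap_space_def mem_Collect_eq near_nn_integral_eq[OF ae]
    using n w0 measurable_completion[of w lborel borel] by auto
  moreover have "L2_norm \<Omega> w = 1" using L2_norm_eq_1_iff[OF w ae w0(2)] S by simp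
  ultimately show ?thesis unfolding log_lap_values_def by blast
qed

section \<open>The sets of values are nonempty and, for balls, bounded below\<close>

lemma nn_integral_weak_singularity:
  "(\<integral>\<^sup>+z. ennreal ((norm z)\<^sup>2 / norm z ^ DIM('a)) * indicator (cball 0 1) z \<partial>(lborel :: 'a::euclidean_space measure)) < \<infinity>"
proof -
  define N where "N = DIM('a)"
  define V where "V = unit_ball_vol (real N)"
  have V: "V \<ge> 0" by (simp add: V_def)
  \<comment> \<open>Dyadic shells: for \<open>(1 / 2) ^ Suc k < norm z \<le> (1 / 2) ^ k\<close> the
    numerator is at most \<open>(1 / 4) ^ k\<close> and the reciprocal of the denominator at most
    \<open>(2 ^ Suc k) ^ N\<close>. The ball \<open>B k\<close> has volume
    \<open>V * ((1 / 2) ^ k) ^ N\<close>, so the terms sum as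
    \<open>V * 2 ^ N * (1 / 4) ^ k\<close>.\<close>
  define a :: "nat \<Rightarrow> real" where "a k = (1 / 4) ^ k * (2 ^ Suc k) ^ N" for k
  have a: "a k \<ge> 0" for k by (simp add: a_def)
  define B where "B k = cball (0::'a) ((1 / 2) ^ k)" for k :: nat
  have B [measurable]: "B k \<in> sets borel" for k by (simp add: B_def)
  have "ennreal ((norm z)\<^sup>2 / norm z ^ N) * indicator (cball 0 1) z \<le> (\<Sum>k. ennreal (a k) * indicator (B k) z)" for z :: 'a
  proof (cases "z \<noteq> 0 \<and> norm z \<le> 1")
    case True
    \<comment> \<open>Minimality yields the upper bound of the shell, except for
      \<open>k = 0\<close>, where it is the assumption \<open>norm z \<le> 1\<close>.\<close>
    define k where "k = (LEAST n. (1 / 2) ^ Suc n < norm z)"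
    obtain n where n: "(1 / 2) ^ n < norm z"
      using real_arch_pow_inv[of "norm z" "1 / 2"] True by auto
    have "(1 / 2 :: real) ^ Suc n \<le> (1 / 2) ^ n" by simp
    with n have ex: "(1 / 2) ^ Suc n < norm z" by linarith
    then have k: "(1 / 2) ^ Suc k < norm z" unfolding k_def by (rule LeastI)
    have zk: "norm z \<le> (1 / 2) ^ k"
    proof (cases k)
      case 0
      then show ?thesis using True by simp
    next
      case (Suc j)
      then have "\<not> (1 / 2) ^ Suc j < norm z"
        unfolding k_def by (intro not_less_Least) simp
      then show ?thesis using Suc by simp
    qed
    have "1 / norm z ^ N \<le> 1 / ((1 / 2) ^ Suc k) ^ N"
      using k by (intro inverse_power_antimono) auto
    also have "\<dots> = (2 ^ Suc k) ^ N" by (simp add: power_divide)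
    finally have 1: "1 / norm z ^ N \<le> (2 ^ Suc k) ^ N" .
    have "(norm z)\<^sup>2 \<le> ((1 / 2) ^ k)\<^sup>2" using zk by (intro power_mono) auto
    also have "\<dots> = ((1 / 2)\<^sup>2) ^ k" by (simp only: power_mult[symmetric] mult.commute)
    also have "\<dots> = (1 / 4) ^ k" by (simp add: power2_eq_square)
    finally have "(norm z)\<^sup>2 * (1 / norm z ^ N) \<le> a k"
      unfolding a_def using 1 by (intro mult_mono) auto
    then have "ennreal ((norm z)\<^sup>2 / norm z ^ N) * indicator (cball 0 1) z \<le> ennreal (a k) * indicator (B k) z"
      using True zk by (auto simp: B_def indicator_def intro: ennreal_leI)
    also have "\<dots> \<le> (\<Sum>k. ennreal (a k) * indicator (B k) z)"
    proof -
      define F where "F k = ennreal (a k) * indicator (B k) z" for k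
      have "sum F {k} \<le> suminf F" by (rule sum_le_suminf) (auto intro: summableI)
      then have "F k \<le> suminf F" by simp
      then show ?thesis by (simp only: F_def[abs_def])
    qed
    finally show ?thesis .
  qed (auto simp: indicator_def)
  then have "(\<integral>\<^sup>+z. ennreal ((norm z)\<^sup>2 / norm z ^ N) * indicator (cball 0 1) z \<partial>(lborel :: 'a measure))
      \<le> (\<integral>\<^sup>+z. (\<Sum>k. ennreal (a k) * indicator (B k) z) \<partial>lborel)"
    by (rule nn_integral_mono)
  also have "\<dots> = (\<Sum>k. ennreal (a k) * emeasure lborel (B k))"
    by (subst nn_integral_suminf) (simp_all add: nn_integral_cmult)
  also have "\<dots> = (\<Sum>k. ennreal (V * 2 ^ N * (1 / 4) ^ k))"
  proof (rule suminf_cong)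
    fix k
    have "emeasure lborel (B k) = ennreal (V * ((1 / 2) ^ k) ^ N)"
      unfolding B_def V_def N_def by (subst emeasure_cball) auto
    then have "ennreal (a k) * emeasure lborel (B k) = ennreal (a k * (V * ((1 / 2) ^ k) ^ N))"
      using a V by (simp add: ennreal_mult)
    also have "a k * (V * ((1 / 2) ^ k) ^ N) = V * 2 ^ N * (1 / 4) ^ k"
      by (simp add: a_def power_divide power_mult_distrib)
    finally show "ennreal (a k) * emeasure lborel (B k) = ennreal (V * 2 ^ N * (1 / 4) ^ k)" .
  qed
  also have "\<dots> = ennreal (\<Sum>k. V * 2 ^ N * (1 / 4) ^ k)"
    using V by (intro suminf_ennreal2 summable_mult summable_geometric) auto
  also have "\<dots> < \<infinity>" by simp
  finally show ?thesis by (simp add: N_def)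
qed

lemma log_near_energy_lipschitz_finite:
  fixes f :: "'a::euclidean_space \<Rightarrow> real"
  assumes lip: "\<And>x y. \<bar>f x - f y\<bar> \<le> L * norm (x - y)" and out: "\<And>x. x \<notin> ball p d \<Longrightarrow> f x = 0"
  shows "log_near_energy f < \<infinity>"
proof -
  define \<kappa> where "\<kappa> = (\<integral>\<^sup>+z. ennreal ((norm z)\<^sup>2 / norm z ^ DIM('a)) * indicator (cball 0 1) z \<partial>(lborel :: 'a measure))"
  \<comment> \<open>The radius is \<open>d + 1\<close> because the integrand is nonzero only if
    \<open>x\<close> or \<open>y\<close> lies in the support, and then the other is at distance at
    most 1 from it.\<close>
  define G where "G x y = indicator (ball p (d + 1)) x * (ennreal (L\<^sup>2) * (ennreal ((norm (x - y))\<^sup>2 / norm (x - y) ^ DIM('a)) * indicator (cball 0 1) (y - x)))" for x y :: 'a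
  have G: "(\<lambda>(x, y). G x y) \<in> borel_measurable (lborel \<Otimes>\<^sub>M lborel)"
    unfolding G_def indicator_def mem_cball mem_ball dist_norm by measurable
  have "log_near_energy f \<le> (\<integral>\<^sup>+(x, y). G x y \<partial>lborel)"
    unfolding near_energy_def
  proof (rule nn_integral_mono, clarify)
    fix x y :: 'a
    show "ennreal ((f x - f y)\<^sup>2 * (1 / norm (x - y) ^ DIM('a))) * indicator {(x, y). norm (x - y) \<le> 1} (x, y) \<le> G x y"
    proof (cases "norm (x - y) \<le> 1 \<and> f x \<noteq> f y")
      case True
      then have "x \<in> ball p d \<or> y \<in> ball p d" using out by metis
      then have "dist p x < d \<or> dist p y < d" by (simp only: mem_ball)
      moreover have "dist p x \<le> dist p y + dist x y" by (metis dist_commute dist_triangle)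
      moreover have "dist x y \<le> 1" using True by (simp add: dist_norm)
      ultimately have "dist p x < d + 1" by linarith
      then have x: "x \<in> ball p (d + 1)" by (simp only: mem_ball)
      have "\<bar>f x - f y\<bar>\<^sup>2 \<le> (L * norm (x - y))\<^sup>2" by (intro power_mono lip) auto
      then have "(f x - f y)\<^sup>2 * (1 / norm (x - y) ^ DIM('a)) \<le> L\<^sup>2 * (norm (x - y))\<^sup>2 * (1 / norm (x - y) ^ DIM('a))"
        by (intro mult_right_mono) (auto simp: power_mult_distrib)
      then have "ennreal ((f x - f y)\<^sup>2 * (1 / norm (x - y) ^ DIM('a))) \<le> ennreal (L\<^sup>2) * ennreal ((norm (x - y))\<^sup>2 / norm (x - y) ^ DIM('a))"
        by (simp add: ennreal_leI flip: ennreal_mult)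
      then show ?thesis using True x by (simp add: G_def indicator_def norm_minus_commute)
    qed (auto simp: indicator_def)
  qed
  also have "\<dots> = (\<integral>\<^sup>+x. (\<integral>\<^sup>+y. G x y \<partial>lborel) \<partial>lborel)"
    using lborel.nn_integral_fst[OF G] by (simp add: lborel_prod)
  also have "\<dots> = (\<integral>\<^sup>+x. indicator (ball p (d + 1)) x * (ennreal (L\<^sup>2) * \<kappa>) \<partial>lborel)"
  proof (rule nn_integral_cong)
    fix x :: 'a
    have m: "G x \<in> borel_measurable borel"
      unfolding G_def indicator_def mem_cball mem_ball dist_norm by measurable
    have [measurable]: "cball (0::'a) 1 \<in> sets borel" by simp
    have mk: "(\<lambda>z. ennreal ((norm z)\<^sup>2 / norm z ^ DIM('a)) * indicator (cball 0 1) z) \<in> borel_measurable (lborel :: 'a measure)"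
      by measurable
    have "(\<integral>\<^sup>+y. G x y \<partial>lborel) = (\<integral>\<^sup>+y. G x (x + y) \<partial>lborel)"
      by (rule nn_integral_lborel_translate[OF m, symmetric])
    also have "\<dots> = (\<integral>\<^sup>+y. (indicator (ball p (d + 1)) x * ennreal (L\<^sup>2)) * (ennreal ((norm (y :: 'a))\<^sup>2 / norm y ^ DIM('a)) * indicator (cball 0 1) y) \<partial>lborel)"
      by (intro nn_integral_cong) (simp add: G_def mult.assoc)
    also have "\<dots> = (indicator (ball p (d + 1)) x * ennreal (L\<^sup>2)) * \<kappa>"
      unfolding \<kappa>_def by (rule nn_integral_cmult[OF mk])
    finally show "(\<integral>\<^sup>+y. G x y \<partial>lborel) = indicator (ball p (d + 1)) x * (ennreal (L\<^sup>2) * \<kappa>)"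
      by (simp add: mult.assoc)
  qed
  also have "\<dots> = emeasure lborel (ball p (d + 1)) * (ennreal (L\<^sup>2) * \<kappa>)"
    by (subst nn_integral_multc) (auto intro!: borel_measurable_indicator)
  also have "\<dots> < \<infinity>"
    using nn_integral_weak_singularity[where 'a = 'a] emeasure_lborel_ball_finite[of p "d + 1"]
    by (simp add: ennreal_mult_less_top \<kappa>_def)
  finally show ?thesis .
qed

text \<open>A tent function on a ball inside \<open>\<Omega>\<close> is Lipschitz with bounded
  support, hence of finite near energy; dividing by its norm makes it admissible.\<close>

lemma log_lap_values_nonempty:
  fixes \<Omega> :: "'a::euclidean_space set"
  assumes "open \<Omega>" "\<Omega> \<noteq> {}"
  shows "log_lap_values \<Omega> \<noteq> {}"
proof -
  obtain p d where d: "d > 0" "ball p d \<subseteq> \<Omega>"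
    using assms open_contains_ball by blast
  define u where "u x = max 0 (d - norm (x - p))" for x
  have [measurable]: "u \<in> borel_measurable borel" unfolding u_def by measurable
  have out: "u x = 0" if "x \<notin> ball p d" for x
    using that by (auto simp: u_def dist_norm norm_minus_commute)
  have u0: "0 \<le> u x" "u x \<le> d" for x using d by (auto simp: u_def)
  have lip: "\<bar>u x - u y\<bar> \<le> norm (x - y)" for x y
  proof -
    have "\<bar>norm (x - p) - norm (y - p)\<bar> \<le> norm (x - y)"
      using norm_triangle_ineq3[of "x - p" "y - p"] by simp
    then show ?thesis unfolding u_def by (auto simp: max_def)
  qed
  define S where "S = (\<integral>\<^sup>+x. ennreal ((u x)\<^sup>2) \<partial>lborel)"
  have "S \<le> (\<integral>\<^sup>+x. ennreal (d\<^sup>2) * indicator (ball p d) x \<partial>lborel)"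
    unfolding S_def
  proof (rule nn_integral_mono)
    fix x
    show "ennreal ((u x)\<^sup>2) \<le> ennreal (d\<^sup>2) * indicator (ball p d) x"
      using out[of x] power_mono[OF u0(2)[of x] u0(1)[of x], of 2] by (auto simp: indicator_def intro: ennreal_leI)
  qed
  also have "\<dots> = ennreal (d\<^sup>2) * emeasure lborel (ball p d)"
    by (subst nn_integral_cmult) (auto intro!: borel_measurable_indicator)
  also have "\<dots> < \<infinity>" using emeasure_lborel_ball_finite[of p d] by (simp add: ennreal_mult_less_top)
  finally have Sfin: "S < \<infinity>" .
  have "0 < ennreal ((d / 2)\<^sup>2) * emeasure lborel (ball p (d / 2))"
    using d by (auto simp: ennreal_zero_less_mult_iff emeasure_ball)
  also have "\<dots> = (\<integral>\<^sup>+x. ennreal ((d / 2)\<^sup>2) * indicator (ball p (d / 2)) x \<partial>lborel)"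
    by (subst nn_integral_cmult) (auto intro!: borel_measurable_indicator)
  also have "\<dots> \<le> S"
    unfolding S_def
  proof (rule nn_integral_mono)
    fix x
    show "ennreal ((d / 2)\<^sup>2) * indicator (ball p (d / 2)) x \<le> ennreal ((u x)\<^sup>2)"
    proof (cases "x \<in> ball p (d / 2)")
      case True
      then have "norm (x - p) < d / 2" by (simp add: dist_norm norm_minus_commute)
      then have "d / 2 \<le> u x" unfolding u_def by linarith
      then have "(d / 2)\<^sup>2 \<le> (u x)\<^sup>2" using d by (intro power_mono) auto
      then show ?thesis using True by (simp add: ennreal_leI)
    qed simp
  qed
  finally have Spos: "0 < S" .
  obtain s where s: "S = ennreal s" "s > 0"
    using Sfin Spos by (cases S rule: ennreal_cases) auto
  define w where "w x = u x / sqrt s" for x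
  have [measurable]: "w \<in> borel_measurable borel" unfolding w_def by measurable
  have "reduced_form w \<in> log_lap_values \<Omega>"
  proof (rule reduced_form_in_log_lap_values)
    show "w x = 0" if "x \<notin> \<Omega>" for x
    proof -
      have "x \<notin> ball p d" using that d(2) by blast
      then show ?thesis by (simp add: w_def out)
    qed
    have "(\<integral>\<^sup>+x. ennreal ((w x)\<^sup>2) \<partial>lborel) = (\<integral>\<^sup>+x. ennreal (1 / s) * ennreal ((u x)\<^sup>2) \<partial>lborel)"
      using s by (intro nn_integral_cong) (simp add: w_def power_divide flip: ennreal_mult)
    also have "\<dots> = ennreal (1 / s) * S"
      unfolding S_def by (rule nn_integral_cmult) simp
    also have "\<dots> = 1" using s by (simp flip: ennreal_mult)
    finally show "(\<integral>\<^sup>+x. ennreal ((w x)\<^sup>2) \<partial>lborel) = 1" .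
    show "log_near_energy w < \<infinity>"
    proof (rule log_near_energy_lipschitz_finite)
      show "\<bar>w x - w y\<bar> \<le> (1 / sqrt s) * norm (x - y)" for x y
        using lip[of x y] s by (simp add: w_def divide_right_mono flip: diff_divide_distrib)
      show "w x = 0" if "x \<notin> ball p d" for x using out[OF that] by (simp add: w_def)
    qed
  qed (use u0 s in \<open>auto simp: w_def\<close>)
  then show ?thesis by blast
qed

text \<open>The near part is nonnegative. The far energy is at most the squared integral of
  \<open>f\<close>, and that integral is at most the volume of the ball plus the unit square
  integral.\<close>

lemma log_lap_values_bdd_below: "bdd_below (log_lap_values (ball (0::'a::euclidean_space) r))"
proof (rule bdd_belowI)
  fix v assume "v \<in> log_lap_values (ball (0::'a) r)"
  then obtain u where v: "v = log_lap_form u u" and u: "u \<in> log_lap_space (ball (0::'a) r)" "L2_norm (ball 0 r) u = 1"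
    by (auto simp: log_lap_values_def)
  obtain f :: "'a \<Rightarrow> real" where f: "symmetrizable f r" "(\<integral>\<^sup>+x. ennreal ((f x)\<^sup>2) \<partial>lborel) = 1" "reduced_form f \<le> v"
    using log_lap_form_ge_reduced_form[OF open_ball subset_refl u] unfolding v by blast
  interpret f: symmetrizable f r by fact
  define b where "b = measure lborel (ball (0::'a) r)"
  have "(\<integral>\<^sup>+x. ennreal (f x) \<partial>lborel) \<le> ennreal (b + 1)"
    using f.nn_integral_le_square emeasure_lborel_ball_finite[of "0::'a" r]
    by (simp add: f(2) b_def emeasure_eq_ennreal_measure ennreal_plus)
  then have "far_energy f \<le> (ennreal (b + 1))\<^sup>2"
    using far_energy_le[OF f.meas f.nonneg] by (meson order_trans power_mono zero_le)
  also have "\<dots> = ennreal ((b + 1)\<^sup>2)" by (rule ennreal_power) (simp add: b_def)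
  finally have "enn2real (far_energy f) \<le> (b + 1)\<^sup>2"
    by (simp add: enn2real_leI)
  then have "log_lap_c DIM('a) * enn2real (far_energy f) \<le> log_lap_c DIM('a) * (b + 1)\<^sup>2"
    using log_lap_c_pos[where 'a = 'a] by (intro mult_left_mono) auto
  moreover have "0 \<le> log_lap_c DIM('a) / 2 * enn2real (log_near_energy f)"
    using log_lap_c_pos[where 'a = 'a] by (intro mult_nonneg_nonneg) auto
  ultimately have "- (log_lap_c DIM('a) * (b + 1)\<^sup>2) + log_lap_rho DIM('a) \<le> reduced_form f"
    unfolding reduced_form_def by linarith
  with f(3) show "- (log_lap_c DIM('a) * (b + 1)\<^sup>2) + log_lap_rho DIM('a) \<le> v" by linarith
qed

theorem corollary1p6:
  fixes \<rho> r :: real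
  assumes "\<rho> > 0"
    and "measure lebesgue (ball (0::'a::euclidean_space) r) = \<rho>"
  shows "\<forall>\<Omega>::'a set. bounded_lipschitz_domain \<Omega> \<and> measure lebesgue \<Omega> = \<rho> \<longrightarrow>
           log_lap_lambda1 (ball (0::'a) r) \<le> log_lap_lambda1 \<Omega>"
proof (intro allI impI, elim conjE)
  fix \<Omega> :: "'a set"
  assume \<Omega>: "bounded_lipschitz_domain \<Omega>" "measure lebesgue \<Omega> = \<rho>"
  then have op: "open \<Omega>" "\<Omega> \<noteq> {}" "bounded \<Omega>" by (auto simp: bounded_lipschitz_domain_def)
  have r: "0 \<le> r" using assms by (cases "0 \<le> r") (auto simp: ball_empty)
  have mball: "measure lborel (ball (0::'a) r) = \<rho>" and m\<Omega>: "measure lborel \<Omega> = \<rho>"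
    using assms(2) \<Omega>(2) op(1) by (simp_all add: measure_completion)
  obtain M where M: "\<Omega> \<subseteq> ball 0 M"
    using bounded_subset_ballD[OF op(3), of 0] by blast
  show "log_lap_lambda1 (ball (0::'a) r) \<le> log_lap_lambda1 \<Omega>"
    unfolding log_lap_lambda1_def
  \<comment> \<open>It suffices to find below each value for \<open>\<Omega>\<close> some value for
    the ball, so attainment of the minimum does not enter.\<close>
  proof (rule cInf_mono)
    show "log_lap_values \<Omega> \<noteq> {}" using op by (intro log_lap_values_nonempty)
    show "bdd_below (log_lap_values (ball (0::'a) r))" by (rule log_lap_values_bdd_below)
    fix v assume "v \<in> log_lap_values \<Omega>"
    then obtain u where v: "v = log_lap_form u u" and u: "u \<in> log_lap_space \<Omega>" "L2_norm \<Omega> u = 1"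
      by (auto simp: log_lap_values_def)
    obtain f where f: "symmetrizable f M" "\<And>x. x \<notin> \<Omega> \<Longrightarrow> f x = 0" "(\<integral>\<^sup>+x. ennreal ((f x)\<^sup>2) \<partial>lborel) = 1"
        "log_near_energy f < \<infinity>" "reduced_form f \<le> v"
      using log_lap_form_ge_reduced_form[OF op(1) M u] unfolding v by blast
    interpret f: symmetrizable f M by fact
    \<comment> \<open>The set where \<open>f\<close> is positive lies in \<open>\<Omega>\<close>,
      whose volume is that of the ball; therefore the rearrangement is supported in precisely the
      ball of radius \<open>r\<close>.\<close>
    have "f.dist_fun 0 \<le> measure lborel \<Omega>"
    proof (rule measure_mono_fmeasurable)
      show "{y. 0 < f y} \<subseteq> \<Omega>" using f(2) by force
      show "\<Omega> \<in> fmeasurable lborel" using op(1) M by (intro fmeasurable_lborel_bounded) auto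
    qed (simp add: f.level_sets)
    then have d0: "f.dist_fun 0 \<le> measure lborel (ball (0::'a) r)" by (simp add: m\<Omega> mball)
    define w where "w = symmetrize f"
    interpret w: symmetrizable w r
      unfolding w_def using d0 r by (rule f.symmetrizable_symmetrize)
    have Sw: "(\<integral>\<^sup>+x. ennreal ((w x)\<^sup>2) \<partial>lborel) = 1"
      unfolding w_def f.nn_integral_symmetrize_square by (rule f(3))
    have far: "far_energy f < \<infinity>" "far_energy w < \<infinity>"
      using f.finite_integrals(2) w.finite_integrals(2) f(3) Sw by simp_all
    have le: "log_near_energy w + 2 * far_energy f \<le> log_near_energy f + 2 * far_energy w"
      unfolding w_def using f(3) by (intro f.energy_symmetrize) simp
    \<comment> \<open>Finiteness of the near energy of \<open>w\<close>, needed for membership in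
      the space of the ball, is extracted from the comparison itself before any term is
      subtracted.\<close>
    have "log_near_energy w \<le> log_near_energy w + 2 * far_energy f" by simp
    also note le
    also have fin: "log_near_energy f + 2 * far_energy w < \<infinity>"
      using f(4) far by (simp add: ennreal_mult_less_top)
    finally have nw: "log_near_energy w < \<infinity>" .
    have "enn2real (log_near_energy w + 2 * far_energy f) \<le> enn2real (log_near_energy f + 2 * far_energy w)"
      using le fin by (intro enn2real_mono) auto
    then have "enn2real (log_near_energy w) + 2 * enn2real (far_energy f)
        \<le> enn2real (log_near_energy f) + 2 * enn2real (far_energy w)"
      using nw f(4) far by (simp add: enn2real_plus enn2real_mult ennreal_mult_less_top)
    then have "log_lap_c DIM('a) / 2 * (enn2real (log_near_energy w) + 2 * enn2real (far_energy f))
        \<le> log_lap_c DIM('a) / 2 * (enn2real (log_near_energy f) + 2 * enn2real (far_energy w))"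
      using log_lap_c_pos[where 'a = 'a] by (intro mult_left_mono) auto
    then have "reduced_form w \<le> reduced_form f"
      unfolding reduced_form_def by (simp add: algebra_simps)
    moreover have "reduced_form w \<in> log_lap_values (ball (0::'a) r)"
      by (rule reduced_form_in_log_lap_values[OF w.meas w.nonneg w.outside Sw nw])
    ultimately show "\<exists>a\<in>log_lap_values (ball (0::'a) r). a \<le> v"
      using f(5) by (intro bexI[of _ "reduced_form w"]) auto
  qed
qed

end
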